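(* Let $m\ge3$ be an odd integer and $n=2m$, and let $\lambda\ge1$. Let $\varphi:(0,1)\to(0,\infty)$ be continuous with $\lim_{r\to0^+}\varphi(r)=\infty$. Then there exists a $C^\infty$ positive solution $u$ of $$0\le-\Delta^m u\le e^{u^\lambda}\quad\text{in }\mathbb{R}^n\setminus\{0\}$$ such that $u(x)\neq O(\varphi(|x|))$ as $x\to0$.
   Context: $\Delta^m$ is the $m$-fold iterated Laplacian. For positive functions, "$u(x)\neq O(h(x))$ as $x\to0$" means $\limsup_{x\to0} u(x)/h(x)=\infty$. *)

theory Defs
  imports "HOL-Analysis.Analysis"
begin

definition partial :: "'n::finite \<Rightarrow> (real^'n \<Rightarrow> real) \<Rightarrow> real^'n \<Rightarrow> real" where
  "partial i f x = deriv (\<lambda>t. f (x + t *\<^sub>R axis i 1)) 0"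

definition smooth_on :: "(real^'n::finite) set \<Rightarrow> (real^'n \<Rightarrow> real) \<Rightarrow> bool" where
  "smooth_on S f \<longleftrightarrow> (\<forall>is. (foldr partial is f) differentiable_on S)"

definition laplacian :: "(real^'n::finite \<Rightarrow> real) \<Rightarrow> real^'n \<Rightarrow> real" where
  "laplacian f x = (\<Sum>i\<in>UNIV. partial i (partial i f) x)"

end

theory Submission
  imports Defs
begin

text \<open>
  In dimension \<open>n = 2m\<close> the function \<open>-ln(|y|\<^sup>2 + e)\<close> satisfies the conformal identity
  \<open>(-\<Delta>)^m (-ln(|y|\<^sup>2 + e)) = 4^m (2m-1)! e^m (|y|\<^sup>2 + e)^(-2m)\<close>, whose right-hand side is, for
  \<open>e < 1\<close>, at most a constant times \<open>exp(-2m ln(|y|\<^sup>2 + e))\<close>. So \<open>2m\<close> times this function solves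
  the inequality with \<open>\<lambda> = 1\<close> up to a constant, and its value \<open>-2m ln e\<close> at the origin is as large
  as we please. Cut off at unit scale, it has an error in the transition zone that is bounded
  uniformly in \<open>e\<close>. Rescaled copies are placed in disjoint balls around points \<open>a\<^sub>j \<rightarrow> 0\<close> with radii
  comparable to \<open>|a\<^sub>j|\<close>, so the errors are \<open>O(|x|^(-2m))\<close>. They are absorbed by adding
  \<open>B + A |x|^(-3)\<close>: for odd \<open>m \<ge> 3\<close>, \<open>-\<Delta>^m |x|^(-3)\<close> is a positive multiple of \<open>|x|^(-2m-3)\<close>,
  and \<open>exp(A |x|^(-3))\<close> dominates all the powers of \<open>|x|\<close> that occur.
\<close>

subsection \<open>Smooth functions and the iterated Laplacian\<close>

lemma partial_eqI:
  assumes "(f has_derivative f') (at x)"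
  shows "partial i f x = f' (axis i 1)"
proof -
  have "((\<lambda>t::real. x + t *\<^sub>R axis i 1) has_derivative (\<lambda>t. t *\<^sub>R axis i 1)) (at 0)"
    by (auto intro!: derivative_eq_intros)
  moreover have "(f has_derivative f') (at (x + 0 *\<^sub>R axis i 1))"
    using assms by simp
  ultimately have "((\<lambda>t. f (x + t *\<^sub>R axis i 1)) has_derivative (\<lambda>t. f' (t *\<^sub>R axis i 1))) (at 0)"
    by (rule has_derivative_compose)
  moreover have "f' (t *\<^sub>R axis i 1) = f' (axis i 1) * t" for t
    using assms by (simp add: has_derivative_def linear_simps bounded_linear.linear)
  ultimately have "((\<lambda>t. f (x + t *\<^sub>R axis i 1)) has_real_derivative f' (axis i 1)) (at 0)"
    by (simp add: has_field_derivative_def)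
  then show ?thesis
    unfolding partial_def by (rule DERIV_imp_deriv)
qed

lemma partial_cong:
  assumes "open U" "x \<in> U" "\<And>y. y \<in> U \<Longrightarrow> f y = g y"
  shows "partial i f x = partial i g x"
proof -
  have "((\<lambda>t::real. x + t *\<^sub>R axis i 1) \<longlongrightarrow> x + 0 *\<^sub>R axis i 1) (nhds 0)"
    by (intro tendsto_intros filterlim_ident)
  then have "eventually (\<lambda>t::real. x + t *\<^sub>R axis i 1 \<in> U) (nhds 0)"
    using assms(1,2) by (simp add: topological_tendstoD)
  then have "eventually (\<lambda>t. f (x + t *\<^sub>R axis i 1) = g (x + t *\<^sub>R axis i 1)) (nhds 0)"
    by eventually_elim (use assms(3) in auto)
  then show ?thesis
    unfolding partial_def by (rule deriv_cong_ev) simp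
qed

lemma differentiable_on_cong:
  assumes "f differentiable_on U" "\<And>x. x \<in> U \<Longrightarrow> g x = f x"
  shows "g differentiable_on U"
  using assms unfolding differentiable_on_def differentiable_def
  by (meson has_derivative_transform)

text \<open>Equality on the whole open set, not only at \<open>x\<close>, is the induction
  hypothesis: a partial derivative depends on values near the point, so each one inherits equality
  on \<open>U\<close>.\<close>

lemma foldr_partial_cong:
  assumes "open U" "\<And>y. y \<in> U \<Longrightarrow> f y = g y" "x \<in> U"
  shows "foldr partial js f x = foldr partial js g x"
  using assms(3)
proof (induction js arbitrary: x)
  case (Cons i js)
  then show ?case
    by (simp add: partial_cong[OF assms(1), of x "foldr partial js f" "foldr partial js g"])
qed (use assms in auto)

lemma laplacian_cong:
  assumes "open U" "\<And>y. y \<in> U \<Longrightarrow> f y = g y" "x \<in> U"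
  shows "laplacian f x = laplacian g x"
  using foldr_partial_cong[OF assms, where js = "[i, i]" for i] by (simp add: laplacian_def)

lemma laplacian_pow_cong:
  assumes "open U" "\<And>y. y \<in> U \<Longrightarrow> f y = g y" "x \<in> U"
  shows "(laplacian ^^ k) f x = (laplacian ^^ k) g x"
  using assms(3)
proof (induction k arbitrary: x)
  case (Suc k)
  then show ?case
    by (simp add: laplacian_cong[OF assms(1), of "(laplacian ^^ k) f" "(laplacian ^^ k) g"])
qed (use assms in auto)

lemma smooth_on_cong:
  assumes "open U" "\<And>y. y \<in> U \<Longrightarrow> f y = g y" "smooth_on U g"
  shows "smooth_on U f"
  unfolding smooth_on_def
proof
  fix js :: "'a list"
  have "foldr partial js g differentiable_on U"
    using assms(3) by (simp add: smooth_on_def)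
  then show "foldr partial js f differentiable_on U"
    by (rule differentiable_on_cong) (simp add: foldr_partial_cong[OF assms(1,2)])
qed

lemma smooth_on_subset: "smooth_on U f \<Longrightarrow> V \<subseteq> U \<Longrightarrow> smooth_on V f"
  unfolding smooth_on_def using differentiable_on_subset by blast

text \<open>On an open set, differentiability within the set is differentiability at the point, a
  local notion. This is what lets smoothness of the glued function be checked shell by
  shell.\<close>

lemma smooth_on_local:
  assumes "\<And>x. x \<in> S \<Longrightarrow> \<exists>U. open U \<and> x \<in> U \<and> smooth_on U f"
  shows "smooth_on S f"
  unfolding smooth_on_def differentiable_on_def
proof (intro allI ballI)
  fix js x assume "x \<in> S"
  then obtain U where "open U" "x \<in> U" "smooth_on U f"
    using assms by blast
  then have "foldr partial js f differentiable at x"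
    unfolding smooth_on_def by (metis differentiable_on_eq_differentiable_at)
  then show "foldr partial js f differentiable at x within S"
    by (rule differentiable_at_withinI)
qed

lemma smooth_on_differentiable:
  assumes "smooth_on U f" "open U" "x \<in> U"
  shows "foldr partial js f differentiable (at x)"
  using assms unfolding smooth_on_def by (metis differentiable_on_eq_differentiable_at)

text \<open>Iterated partial derivatives never leave the class \<open>P\<close>, up to equality on
  \<open>U\<close>. So a class of differentiable functions only has to be closed under one partial
  derivative, and no higher derivative need be computed.\<close>

lemma smooth_on_coinduct:
  assumes "open U" "P f"
    and diff: "\<And>g x. P g \<Longrightarrow> x \<in> U \<Longrightarrow> g differentiable (at x)"
    and step: "\<And>g i. P g \<Longrightarrow> \<exists>h. P h \<and> (\<forall>x\<in>U. partial i g x = h x)"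
  shows "smooth_on U f"
proof -
  have ex: "\<exists>h. P h \<and> (\<forall>x\<in>U. foldr partial js f x = h x)" for js
  proof (induction js)
    case Nil
    then show ?case using assms(2) by auto
  next
    case (Cons i js)
    then obtain h where h: "P h" "\<forall>x\<in>U. foldr partial js f x = h x"
      by blast
    obtain h' where "P h'" "\<forall>x\<in>U. partial i h x = h' x"
      using step[OF h(1)] by blast
    moreover have "partial i (foldr partial js f) x = partial i h x" if "x \<in> U" for x
      by (rule partial_cong[OF assms(1) that]) (use h in auto)
    ultimately show ?case by auto
  qed
  show ?thesis
    unfolding smooth_on_def
  proof
    fix js :: "'a list"
    obtain h where h: "P h" "\<forall>x\<in>U. foldr partial js f x = h x"
      using ex by blast
    then have "h differentiable_on U"
      using diff by (simp add: differentiable_at_imp_differentiable_on)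
    then show "foldr partial js f differentiable_on U"
      by (rule differentiable_on_cong) (use h in auto)
  qed
qed

lemma partial_add:
  assumes "f differentiable (at x)" "g differentiable (at x)"
  shows "partial i (\<lambda>x. f x + g x) x = partial i f x + partial i g x"
proof -
  obtain f' g' where "(f has_derivative f') (at x)" "(g has_derivative g') (at x)"
    using assms unfolding differentiable_def by blast
  then show ?thesis
    by (simp add: partial_eqI partial_eqI[OF has_derivative_add])
qed

lemma foldr_partial_add:
  assumes "open U" "smooth_on U f" "smooth_on U g" "x \<in> U"
  shows "foldr partial js (\<lambda>x. f x + g x) x = foldr partial js f x + foldr partial js g x"
  using assms(4)
proof (induction js arbitrary: x)
  case (Cons i js)
  have "partial i (foldr partial js (\<lambda>x. f x + g x)) x
      = partial i (\<lambda>x. foldr partial js f x + foldr partial js g x) x"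
    using Cons by (intro partial_cong[OF assms(1)]) auto
  also have "\<dots> = partial i (foldr partial js f) x + partial i (foldr partial js g) x"
    using smooth_on_differentiable[OF assms(2,1)] smooth_on_differentiable[OF assms(3,1)] Cons
    by (intro partial_add) auto
  finally show ?case by simp
qed auto

lemma smooth_on_add:
  assumes "open U" "smooth_on U f" "smooth_on U g"
  shows "smooth_on U (\<lambda>x. f x + g x)"
  unfolding smooth_on_def
proof
  fix js :: "'a list"
  have "(\<lambda>x. foldr partial js f x + foldr partial js g x) differentiable_on U"
    using assms by (intro differentiable_on_add) (auto simp: smooth_on_def)
  then show "foldr partial js (\<lambda>x. f x + g x) differentiable_on U"
    by (rule differentiable_on_cong) (simp add: foldr_partial_add[OF assms])
qed

lemma smooth_on_partial: "smooth_on U f \<Longrightarrow> smooth_on U (partial i f)"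
  unfolding smooth_on_def
proof
  fix js :: "'a list"
  assume "\<forall>js. foldr partial js f differentiable_on U"
  then have "foldr partial (js @ [i]) f differentiable_on U"
    by blast
  then show "foldr partial js (partial i f) differentiable_on U"
    by simp
qed

lemma smooth_on_sum:
  assumes "open U" "finite A" "\<And>a. a \<in> A \<Longrightarrow> smooth_on U (f a)"
  shows "smooth_on U (\<lambda>x. \<Sum>a\<in>A. f a x)"
  using assms(2,3)
proof (induction A rule: finite_induct)
  case empty
  show ?case
  \<comment> \<open>The class consisting of the zero function alone is closed under partial
    derivatives.\<close>
  proof (rule smooth_on_coinduct[OF assms(1), where P = "\<lambda>g. g = (\<lambda>x. 0)"])
    fix g :: "real^'a \<Rightarrow> real" and i assume "g = (\<lambda>x. 0)"
    then show "\<exists>h. h = (\<lambda>x. 0) \<and> (\<forall>x\<in>U. partial i g x = h x)"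
      by (simp add: partial_eqI[OF has_derivative_const])
  qed auto
next
  case (insert a A)
  then show ?case
    by (simp add: smooth_on_add assms(1))
qed

lemma smooth_on_laplacian:
  assumes "open U" "smooth_on U f"
  shows "smooth_on U (laplacian f)"
proof -
  have "smooth_on U (\<lambda>x. \<Sum>i\<in>UNIV. partial i (partial i f) x)"
    using assms by (intro smooth_on_sum smooth_on_partial) auto
  then show ?thesis
    by (simp add: laplacian_def[abs_def])
qed

lemma smooth_on_laplacian_pow:
  assumes "open U" "smooth_on U f"
  shows "smooth_on U ((laplacian ^^ k) f)"
  using assms by (induction k) (auto intro: smooth_on_laplacian)

lemma laplacian_pow_add:
  assumes "open U" "smooth_on U f" "smooth_on U g" "x \<in> U"
  shows "(laplacian ^^ k) (\<lambda>x. f x + g x) x = (laplacian ^^ k) f x + (laplacian ^^ k) g x"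
  using assms(4)
proof (induction k arbitrary: x)
  case (Suc k)
  have "laplacian ((laplacian ^^ k) (\<lambda>x. f x + g x)) x
      = laplacian (\<lambda>x. (laplacian ^^ k) f x + (laplacian ^^ k) g x) x"
    using Suc by (intro laplacian_cong[OF assms(1)]) auto
  also have "\<dots> = laplacian ((laplacian ^^ k) f) x + laplacian ((laplacian ^^ k) g) x"
    using foldr_partial_add[OF assms(1) smooth_on_laplacian_pow[OF assms(1,2)]
        smooth_on_laplacian_pow[OF assms(1,3)] Suc(2), where js = "[i, i]" for i]
    by (simp add: laplacian_def sum.distrib)
  finally show ?case by simp
qed auto

section \<open>Behaviour under translation and dilation\<close>

lemma partial_affine:
  assumes "f differentiable (at (c *\<^sub>R (x - a)))"
  shows "partial i (\<lambda>x. f (c *\<^sub>R (x - a))) x = c * partial i f (c *\<^sub>R (x - a))"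
proof -
  obtain f' where f': "(f has_derivative f') (at (c *\<^sub>R (x - a)))"
    using assms unfolding differentiable_def by blast
  have "((\<lambda>x. c *\<^sub>R (x - a)) has_derivative (\<lambda>h. c *\<^sub>R h)) (at x)"
    by (auto intro!: derivative_eq_intros)
  from partial_eqI[OF has_derivative_compose[OF this f'], of i]
  have "partial i (\<lambda>x. f (c *\<^sub>R (x - a))) x = f' (c *\<^sub>R axis i 1)" .
  also have "\<dots> = c * f' (axis i 1)"
    using has_derivative_linear[OF f'] by (simp add: linear_scale)
  finally show ?thesis
    using partial_eqI[OF f', of i] by simp
qed

lemma partial_cmult:
  assumes "f differentiable (at x)"
  shows "partial i (\<lambda>x. c * f x) x = c * partial i f x"
proof -
  obtain f' where "(f has_derivative f') (at x)"
    using assms unfolding differentiable_def by blast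
  then show ?thesis
    by (simp add: partial_eqI partial_eqI[OF has_derivative_mult_right])
qed

lemma differentiable_affine:
  fixes f :: "real^'n \<Rightarrow> real"
  assumes "f differentiable (at (c *\<^sub>R (x - a)))"
  shows "(\<lambda>x. f (c *\<^sub>R (x - a))) differentiable (at x)"
proof -
  obtain f' where f': "(f has_derivative f') (at (c *\<^sub>R (x - a)))"
    using assms unfolding differentiable_def by blast
  have "((\<lambda>x. c *\<^sub>R (x - a)) has_derivative (\<lambda>h. c *\<^sub>R h)) (at x)"
    by (auto intro!: derivative_eq_intros)
  from has_derivative_compose[OF this f'] show ?thesis
    unfolding differentiable_def by blast
qed

lemma foldr_partial_affine:
  assumes "smooth_on UNIV f"
  shows "foldr partial js (\<lambda>x. f (c *\<^sub>R (x - a))) = (\<lambda>x. c ^ length js * foldr partial js f (c *\<^sub>R (x - a)))"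
proof (induction js)
  case (Cons i js)
  have d: "foldr partial js f differentiable (at y)" for y
    using smooth_on_differentiable[OF assms] by simp
  show ?case
    by (rule ext) (simp add: Cons partial_cmult partial_affine differentiable_affine d)
qed auto

lemma smooth_on_affine:
  assumes "smooth_on UNIV f"
  shows "smooth_on UNIV (\<lambda>x. f (c *\<^sub>R (x - a)))"
  unfolding smooth_on_def foldr_partial_affine[OF assms] differentiable_on_def
  using smooth_on_differentiable[OF assms]
  by (auto intro!: differentiable_mult differentiable_affine)

text \<open>Each Laplacian takes two partial derivatives, and each of these contributes one factor
  \<open>c\<close>. For a bubble shrunk to radius \<open>r\<close> this yields the factor
  \<open>r^(-2m)\<close>.\<close>

lemma laplacian_pow_affine:
  assumes "smooth_on UNIV f"
  shows "(laplacian ^^ k) (\<lambda>x. f (c *\<^sub>R (x - a))) = (\<lambda>x. c ^ (2 * k) * (laplacian ^^ k) f (c *\<^sub>R (x - a)))"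
proof (induction k)
  case (Suc k)
  define h where "h = (laplacian ^^ k) f"
  have h: "smooth_on UNIV h"
    using smooth_on_laplacian_pow[OF _ assms] by (simp add: h_def)
  have d: "h differentiable (at y)" "partial i h differentiable (at y)" for y i
    using smooth_on_differentiable[OF h, of y "[]"] smooth_on_differentiable[OF h, of y "[i]"] by auto
  have "partial i (\<lambda>x. c ^ (2 * k) * h (c *\<^sub>R (x - a))) = (\<lambda>x. c ^ (2 * k) * (c * partial i h (c *\<^sub>R (x - a))))" for i
    by (rule ext) (simp add: partial_cmult partial_affine differentiable_affine d)
  then have "laplacian (\<lambda>x. c ^ (2 * k) * h (c *\<^sub>R (x - a))) x
      = c ^ (2 * k) * c\<^sup>2 * laplacian h (c *\<^sub>R (x - a))" for x
    by (simp add: laplacian_def partial_cmult partial_affine differentiable_affine d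
        sum_distrib_left power2_eq_square mult.assoc)
  then show ?case
    using Suc by (auto simp: h_def power2_eq_square algebra_simps)
qed auto

subsection \<open>Radial functions\<close>

text \<open>A one-variable function \<open>D 0\<close> is carried together with a formula for each
  of its derivatives, so that higher derivatives can be manipulated and bounded explicitly. The
  derivatives are two-sided, also at boundary points of \<open>I\<close>.\<close>

definition deriv_seq :: "real set \<Rightarrow> (nat \<Rightarrow> real \<Rightarrow> real) \<Rightarrow> bool" where
  "deriv_seq I D \<longleftrightarrow> (\<forall>k. \<forall>t\<in>I. (D k has_real_derivative D (Suc k) t) (at t))"

lemma deriv_seqD: "deriv_seq I D \<Longrightarrow> t \<in> I \<Longrightarrow> (D k has_real_derivative D (Suc k) t) (at t)"
  by (simp add: deriv_seq_def)

lemma has_derivative_radial: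
  fixes x :: "real^'n"
  assumes "(q has_real_derivative d) (at (x \<bullet> x))"
  shows "((\<lambda>x. q (x \<bullet> x)) has_derivative (\<lambda>h. d * (2 * (x \<bullet> h)))) (at x)"
proof -
  have "((\<lambda>x. x \<bullet> x) has_derivative (\<lambda>h. 2 * (x \<bullet> h))) (at x)"
    by (auto intro!: derivative_eq_intros simp: inner_commute)
  from has_derivative_compose[OF this assms[unfolded has_field_derivative_def]]
  show ?thesis .
qed

lemma partial_radial:
  fixes x :: "real^'n"
  assumes "(q has_real_derivative d) (at (x \<bullet> x))"
  shows "partial i (\<lambda>x. q (x \<bullet> x)) x = 2 * d * x $ i"
  using partial_eqI[OF has_derivative_radial[OF assms], of i] by (simp add: inner_axis)

lemma has_derivative_coord:
  fixes x :: "real^'n"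
  shows "((\<lambda>x. x $ i) has_derivative (\<lambda>h. h $ i)) (at x)"
  by (rule bounded_linear_imp_has_derivative[OF bounded_linear_vec_nth])

text \<open>The algebra generated by the constants, the coordinates and all
  \<open>D k (|x|^2)\<close>. It contains the radial function \<open>D 0 (|x|^2)\<close> and is
  closed under partial derivatives, as \<open>smooth_on_coinduct\<close> requires.\<close>

inductive radial_alg :: "(nat \<Rightarrow> real \<Rightarrow> real) \<Rightarrow> (real^'n::finite \<Rightarrow> real) \<Rightarrow> bool" for D where
  radial: "radial_alg D (\<lambda>x. D k (x \<bullet> x))"
| const: "radial_alg D (\<lambda>x. c)"
| coord: "radial_alg D (\<lambda>x. x $ i)"
| add: "radial_alg D f \<Longrightarrow> radial_alg D g \<Longrightarrow> radial_alg D (\<lambda>x. f x + g x)"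
| mult: "radial_alg D f \<Longrightarrow> radial_alg D g \<Longrightarrow> radial_alg D (\<lambda>x. f x * g x)"

text \<open>The chain rule gives \<open>2 D (Suc k) (|x|^2) x_i\<close> for a generator, and sums
  and products stay in the algebra. Producing the full derivative \<open>f'\<close> gives
  differentiability and closure in one induction.\<close>

lemma radial_alg_has_derivative:
  assumes "deriv_seq I D" "radial_alg D f"
  shows "\<exists>f'. (\<forall>x. x \<bullet> x \<in> I \<longrightarrow> (f has_derivative f' x) (at x)) \<and> (\<forall>i. radial_alg D (\<lambda>x. f' x (axis i 1)))"
  using assms(2)
proof induction
  case (radial k)
  have "\<forall>i. radial_alg D (\<lambda>x. D (Suc k) (x \<bullet> x) * (2 * x $ i))"
    by (intro allI radial_alg.intros)
  then show ?case
    using has_derivative_radial[OF deriv_seqD[OF assms(1)]]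
    by (intro exI[of _ "\<lambda>x h. D (Suc k) (x \<bullet> x) * (2 * (x \<bullet> h))"]) (auto simp: inner_axis)
next
  case (const c)
  show ?case
    by (intro exI[of _ "\<lambda>x h. 0"]) (auto intro: radial_alg.const)
next
  case (coord i)
  show ?case
    by (intro exI[of _ "\<lambda>x h. h $ i"]) (auto intro: radial_alg.const has_derivative_coord)
next
  case (add f g)
  then obtain f' g' where "\<forall>x. x \<bullet> x \<in> I \<longrightarrow> (f has_derivative f' x) (at x)" "\<forall>i. radial_alg D (\<lambda>x. f' x (axis i 1))"
    "\<forall>x. x \<bullet> x \<in> I \<longrightarrow> (g has_derivative g' x) (at x)" "\<forall>i. radial_alg D (\<lambda>x. g' x (axis i 1))"
    by blast
  then show ?case
    by (intro exI[of _ "\<lambda>x h. f' x h + g' x h"]) (auto intro: radial_alg.add has_derivative_add)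
next
  case (mult f g)
  then obtain f' g' where "\<forall>x. x \<bullet> x \<in> I \<longrightarrow> (f has_derivative f' x) (at x)" "\<forall>i. radial_alg D (\<lambda>x. f' x (axis i 1))"
    "\<forall>x. x \<bullet> x \<in> I \<longrightarrow> (g has_derivative g' x) (at x)" "\<forall>i. radial_alg D (\<lambda>x. g' x (axis i 1))"
    by blast
  moreover from this have "radial_alg D (\<lambda>x. f x * g' x (axis i 1) + f' x (axis i 1) * g x)" for i
    using mult(1,2) by (intro radial_alg.add radial_alg.mult) auto
  ultimately show ?case
    by (intro exI[of _ "\<lambda>x h. f x * g' x h + f' x h * g x"]) (auto intro: has_derivative_mult)
qed

lemma smooth_on_radial:
  fixes U :: "(real^'n::finite) set"
  assumes "deriv_seq I D" "open U" "\<And>x. x \<in> U \<Longrightarrow> x \<bullet> x \<in> I"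
  shows "smooth_on U (\<lambda>x. D 0 (x \<bullet> x))"
proof (rule smooth_on_coinduct[OF assms(2), where P = "radial_alg D"])
  fix g :: "real^'n \<Rightarrow> real" and x i assume "radial_alg D g"
  from radial_alg_has_derivative[OF assms(1) this] obtain f' where
    f': "\<forall>x. x \<bullet> x \<in> I \<longrightarrow> (g has_derivative f' x) (at x)" "\<forall>i. radial_alg D (\<lambda>x. f' x (axis i 1))"
    by blast
  show "\<exists>h. radial_alg D h \<and> (\<forall>x\<in>U. partial i g x = h x)"
    using f' assms(3) by (intro exI[of _ "\<lambda>x. f' x (axis i 1)"]) (auto intro: partial_eqI)
  show "g differentiable at x" if "x \<in> U"
    using f' assms(3)[OF that] unfolding differentiable_def by blast
qed (rule radial_alg.radial)

text \<open>The first derivative must be known as a function near the point because it is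
  differentiated again, whereas \<open>q''\<close> enters only as a number. Summing
  \<open>x_i^2\<close> over the coordinates gives \<open>x \<bullet> x\<close>.\<close>

lemma laplacian_radial:
  fixes x :: "real^'n::finite"
  assumes "open U" "x \<in> U"
    and "\<And>x. x \<in> U \<Longrightarrow> (q has_real_derivative q' (x \<bullet> x)) (at (x \<bullet> x))"
    and "(q' has_real_derivative q'') (at (x \<bullet> x))"
  shows "laplacian (\<lambda>x. q (x \<bullet> x)) x = 4 * (x \<bullet> x) * q'' + 2 * real CARD('n) * q' (x \<bullet> x)"
proof -
  have "partial i (partial i (\<lambda>x. q (x \<bullet> x))) x = 4 * q'' * (x $ i * x $ i) + 2 * q' (x \<bullet> x)" for i
  proof -
    have "partial i (partial i (\<lambda>x. q (x \<bullet> x))) x = partial i (\<lambda>x. 2 * q' (x \<bullet> x) * x $ i) x"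
      using assms(1,2) by (intro partial_cong partial_radial assms(3))
    also have "((\<lambda>x. 2 * q' (x \<bullet> x) * x $ i) has_derivative
        (\<lambda>h. 2 * q' (x \<bullet> x) * (h $ i) + (2 * (q'' * (2 * (x \<bullet> h)))) * x $ i)) (at x)"
      by (intro has_derivative_mult has_derivative_mult_right has_derivative_coord
          has_derivative_radial assms(4))
    from partial_eqI[OF this, of i] have "partial i (\<lambda>x. 2 * q' (x \<bullet> x) * x $ i) x
        = 4 * q'' * (x $ i * x $ i) + 2 * q' (x \<bullet> x)"
      by (simp add: inner_axis algebra_simps)
    finally show ?thesis .
  qed
  then show ?thesis
    by (simp add: laplacian_def sum.distrib inner_vec_def flip: sum_distrib_left)
qed

text \<open>If \<open>D k\<close> is the \<open>k\<close>-th derivative of \<open>q\<close>, then \<open>lap_seq N D k\<close> is the \<open>k\<close>-th derivative of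
  \<open>4 t q'' + 2 N q'\<close>, the Laplacian in dimension \<open>N\<close> of \<open>q(|x|\<^sup>2)\<close> as a function of \<open>t = |x|\<^sup>2\<close>.\<close>

definition lap_seq :: "real \<Rightarrow> (nat \<Rightarrow> real \<Rightarrow> real) \<Rightarrow> nat \<Rightarrow> real \<Rightarrow> real" where
  "lap_seq N D k t = 4 * t * D (Suc (Suc k)) t + (4 * real k + 2 * N) * D (Suc k) t"

text \<open>Differentiating the factor \<open>4 * t\<close> leaves an extra
  \<open>4 * D (Suc (Suc k)) t\<close>, which accounts for the growth of \<open>4 * real k\<close>
  with \<open>k\<close>.\<close>

lemma deriv_seq_lap_seq:
  assumes "deriv_seq I D"
  shows "deriv_seq I (lap_seq N D)"
  unfolding deriv_seq_def lap_seq_def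
proof (intro allI ballI)
  fix k t assume t: "t \<in> I"
  show "((\<lambda>t. 4 * t * D (Suc (Suc k)) t + (4 * real k + 2 * N) * D (Suc k) t) has_real_derivative
     4 * t * D (Suc (Suc (Suc k))) t + (4 * real (Suc k) + 2 * N) * D (Suc (Suc k)) t) (at t)"
    by (rule derivative_eq_intros deriv_seqD[OF assms t] refl)+ (simp add: algebra_simps)
qed

lemma laplacian_pow_radial:
  fixes x :: "real^'n::finite"
  assumes "deriv_seq I D" "open U" "\<And>x. x \<in> U \<Longrightarrow> x \<bullet> x \<in> I" "x \<in> U"
  shows "(laplacian ^^ k) (\<lambda>x. D 0 (x \<bullet> x)) x = (lap_seq (real CARD('n)) ^^ k) D 0 (x \<bullet> x)"
  using assms(1,4)
\<comment> \<open>The innermost Laplacian is peeled off, which replaces \<open>D\<close> by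
  \<open>lap_seq N D\<close>; hence the generalisation over \<open>D\<close>.\<close>
proof (induction k arbitrary: D x)
  case (Suc k)
  have "laplacian (\<lambda>x. D 0 (x \<bullet> x)) y = lap_seq (real CARD('n)) D 0 (y \<bullet> y)" if "y \<in> U" for y
    using deriv_seqD[OF Suc.prems(1)] assms(3)
    by (subst laplacian_radial[OF assms(2) that, where q' = "D (Suc 0)"]) (auto simp: lap_seq_def that)
  then have "(laplacian ^^ k) (laplacian (\<lambda>x. D 0 (x \<bullet> x))) x
      = (laplacian ^^ k) (\<lambda>y. lap_seq (real CARD('n)) D 0 (y \<bullet> y)) x"
    by (rule laplacian_pow_cong[OF assms(2) _ Suc.prems(2)])
  also have "\<dots> = (lap_seq (real CARD('n)) ^^ k) (lap_seq (real CARD('n)) D) 0 (x \<bullet> x)"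
    by (rule Suc.IH[OF deriv_seq_lap_seq[OF Suc.prems(1)] Suc.prems(2)])
  finally show ?case
    by (simp add: funpow_Suc_right del: funpow.simps)
qed auto

text \<open>Closed form of the coefficients of \<open>e^j z^(i+j)\<close>, \<open>z = 1 / (|x|\<^sup>2 + e)\<close>, in
  \<open>(-\<Delta>/4)^i (-ln(|x|\<^sup>2 + e))\<close>, in dimension \<open>2m\<close> and for \<open>i \<ge> 1\<close>. The product contains the factor \<open>m - m\<close> when
  \<open>i = m > j\<close>, so that only \<open>j = m\<close> survives after \<open>m\<close> steps.\<close>

definition bubble_coeff :: "nat \<Rightarrow> nat \<Rightarrow> nat \<Rightarrow> real" where
  "bubble_coeff m i j = real (i choose j) * fact (i + j - 1) * (\<Prod>l\<in>{j<..i}. real m - real l)"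

lemma bubble_coeff_Suc_0:
  assumes "i > 0"
  shows "bubble_coeff m (Suc i) 0 = bubble_coeff m i 0 * (real i * (real m - 1 - real i))"
proof -
  have "{0<..Suc i} = insert (Suc i) {0<..i}"
    by auto
  moreover have "fact i = fact (i - 1) * real i"
    using assms by (cases i) auto
  ultimately show ?thesis
    by (simp add: bubble_coeff_def algebra_simps)
qed

text \<open>With \<open>n = i + j\<close>, the operator \<open>-\<Delta>/4\<close> sends
  \<open>z^n\<close> to \<open>n (m - 1 - n) z^(n+1) + e n (n+1) z^(n+2)\<close>. The coefficient of
  \<open>e^(j+1)\<close> thus has two sources, at \<open>j + 1\<close> and at \<open>j\<close>.
  Absorption for binomials and Pascal's rule combine them.\<close>

lemma bubble_coeff_Suc_Suc:
  assumes "i > 0" "j \<le> i"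
  shows "bubble_coeff m (Suc i) (Suc j) =
     bubble_coeff m i (Suc j) * (real (i + Suc j) * (real m - 1 - real (i + Suc j)))
     + bubble_coeff m i j * (real (i + j) * real (i + j + 1))"
\<comment> \<open>For \<open>j = i\<close> the first source vanishes and the products are empty;
  splitting off the factor for \<open>Suc j\<close> below needs \<open>j < i\<close>.\<close>
proof (cases "j = i")
  case True
  obtain n where n: "i + i = Suc n"
    using assms by (cases "i + i") auto
  then show ?thesis
    by (simp add: True bubble_coeff_def binomial_eq_0 algebra_simps)
next
  case False
  obtain n where n: "i + j = Suc n"
    using assms by (cases "i + j") auto
  define P where "P = (\<Prod>l\<in>{Suc j<..i}. real m - real l)"
  have "{Suc j<..Suc i} = insert (Suc i) {Suc j<..i}" "{j<..i} = insert (Suc j) {Suc j<..i}"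
    using assms False by auto
  then have P: "(\<Prod>l\<in>{Suc j<..Suc i}. real m - real l) = (real m - real (Suc i)) * P"
    "(\<Prod>l\<in>{j<..i}. real m - real l) = (real m - real (Suc j)) * P"
    by (simp_all add: P_def)
  have f: "i + Suc j - 1 = i + j" "Suc i + Suc j - 1 = Suc (i + j)" by auto
  have f1: "fact (i + j) = fact (i + j - 1) * real (i + j)"
    by (simp add: n)
  have "Suc j * (i choose Suc j) = (i - j) * (i choose j)"
    by (simp only: binomial_absorption binomial_absorb_comp)
  then have "real (Suc j * (i choose Suc j)) = real ((i - j) * (i choose j))"
    by (simp only:)
  then have "real (Suc j) * real (i choose Suc j) = (real i - real j) * real (i choose j)"
    unfolding of_nat_mult using assms by (simp only: of_nat_diff)
  then have b: "(real i - real j) * real (i choose j) = real (i choose Suc j) * (real j + 1)"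
    by (simp add: mult.commute add.commute)
  define a c where "a = real (i choose Suc j)" and "c = real (i choose j)"
  have b: "(real i - real j) * c = a * (real j + 1)"
    using b by (simp add: a_def c_def)
  have "bubble_coeff m i (Suc j) * (real (i + Suc j) * (real m - 1 - real (i + Suc j)))
     + bubble_coeff m i j * (real (i + j) * real (i + j + 1))
     = fact (i + j) * real (i + j + 1) * P * (a * (real m - 1 - real (i + Suc j)) + c * (real m - real (Suc j)))"
    unfolding bubble_coeff_def f f1 P P_def[symmetric] a_def[symmetric] c_def[symmetric] by (simp add: algebra_simps)
  also have "a * (real m - 1 - real (i + Suc j)) + c * (real m - real (Suc j)) = (a + c) * (real m - real (Suc i))"
    using b by (simp add: algebra_simps)
  finally show ?thesis
    unfolding bubble_coeff_def f P by (simp add: a_def c_def algebra_simps)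
qed

definition bubble :: "nat \<Rightarrow> nat \<Rightarrow> real \<Rightarrow> real \<Rightarrow> real" where
  "bubble m i e z = (\<Sum>j\<le>i. bubble_coeff m i j * e ^ j * z ^ (i + j))"

text \<open>The right-hand side is \<open>-\<Delta>/4\<close> applied term by term; collecting equal
  powers of \<open>e\<close> turns the recurrence for the coefficients into this identity.\<close>

lemma bubble_Suc:
  assumes "i > 0"
  shows "bubble m (Suc i) e z = (\<Sum>j\<le>i. bubble_coeff m i j * e ^ j *
     (real (i + j) * (real m - 1 - real (i + j)) * z ^ (i + j + 1)
      + e * (real (i + j) * real (i + j + 1)) * z ^ (i + j + 2)))"
proof -
  define X where "X j = e ^ j * z ^ (Suc i + j)" for j
  define A where "A j = bubble_coeff m i j * (real (i + j) * (real m - 1 - real (i + j)))" for j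
  define B where "B j = bubble_coeff m i j * (real (i + j) * real (i + j + 1))" for j
  \<comment> \<open>The binomial coefficient \<open>i choose Suc i\<close> is zero, so the sum may
    be extended by one term and then shifted.\<close>
  have "A (Suc i) = 0"
    by (simp add: A_def bubble_coeff_def)
  then have A: "(\<Sum>j\<le>i. A j * X j) = A 0 * X 0 + (\<Sum>j\<le>i. A (Suc j) * X (Suc j))"
    using sum.atMost_Suc_shift[of "\<lambda>j. A j * X j" i] by simp
  have "bubble m (Suc i) e z = (\<Sum>j\<le>Suc i. bubble_coeff m (Suc i) j * X j)"
    by (simp add: bubble_def X_def mult.assoc)
  also have "\<dots> = bubble_coeff m (Suc i) 0 * X 0 + (\<Sum>j\<le>i. bubble_coeff m (Suc i) (Suc j) * X (Suc j))"
    by (rule sum.atMost_Suc_shift)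
  also have "\<dots> = A 0 * X 0 + (\<Sum>j\<le>i. (A (Suc j) + B j) * X (Suc j))"
    using bubble_coeff_Suc_0[OF assms, of m] bubble_coeff_Suc_Suc[OF assms, of _ m]
    by (simp add: A_def B_def)
  also have "\<dots> = (\<Sum>j\<le>i. A j * X j + B j * X (Suc j))"
    using A by (simp add: sum.distrib ring_distribs)
  also have "\<dots> = (\<Sum>j\<le>i. bubble_coeff m i j * e ^ j *
     (real (i + j) * (real m - 1 - real (i + j)) * z ^ (i + j + 1)
      + e * (real (i + j) * real (i + j + 1)) * z ^ (i + j + 2)))"
    by (intro sum.cong refl) (simp add: A_def B_def X_def algebra_simps)
  finally show ?thesis .
qed

lemma bubble_self:
  assumes "m > 0"
  shows "bubble m m e z = fact (2 * m - 1) * e ^ m * z ^ (2 * m)"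
proof -
  have "bubble_coeff m m j = 0" if "j < m" for j
    using that by (auto simp: bubble_coeff_def intro!: prod_zero)
  then have "bubble m m e z = (\<Sum>j\<in>{m}. bubble_coeff m m j * e ^ j * z ^ (m + j))"
    unfolding bubble_def by (intro sum.mono_neutral_right) auto
  then show ?thesis
    by (simp add: bubble_coeff_def mult_2)
qed

text \<open>The induction starts after one Laplacian, since the logarithm itself is not a polynomial
  in \<open>z\<close>. From then on \<open>|x|^2 z = 1 - e z\<close> eliminates
  \<open>|x|^2\<close>, so every iterate is again a polynomial in \<open>z\<close> and
  \<open>e\<close>.\<close>

lemma laplacian_pow_log_bubble:
  fixes x :: "real^'n::finite"
  assumes "e > 0" and N: "CARD('n) = 2 * m"
  shows "(laplacian ^^ Suc i) (\<lambda>x. - ln (x \<bullet> x + e)) x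
    = (- 4) ^ Suc i * bubble m (Suc i) e (inverse (x \<bullet> x + e))"
proof (induction i arbitrary: x)
  case 0
  have p: "y \<bullet> y + e > 0" for y :: "real^'n"
    using assms(1) by (simp add: add_nonneg_pos)
  define z where "z = inverse (x \<bullet> x + e)"
  have sz: "(x \<bullet> x) * z = 1 - e * z"
    using p[of x] by (simp add: z_def field_simps)
  have "laplacian (\<lambda>x. - ln (x \<bullet> x + e)) x
      = 4 * (x \<bullet> x) * z\<^sup>2 + 2 * real CARD('n) * (- inverse (x \<bullet> x + e))"
    using p
    by (intro laplacian_radial[of UNIV])
      (auto intro!: derivative_eq_intros simp: less_imp_neq[symmetric] power2_eq_square z_def inverse_eq_divide)
  also have "\<dots> = 4 * ((x \<bullet> x) * z) * z - 4 * real m * z"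
    by (simp add: N z_def power2_eq_square)
  also have "\<dots> = - 4 * ((real m - 1) * z + e * z\<^sup>2)"
    unfolding sz by (simp add: power2_eq_square algebra_simps)
  also have "(real m - 1) * z + e * z\<^sup>2 = bubble m (Suc 0) e z"
  proof -
    have "{0<..Suc 0} = {Suc 0}" by auto
    then show ?thesis
      by (simp add: bubble_def bubble_coeff_def power2_eq_square)
  qed
  finally show ?case by (simp add: z_def)
next
  case (Suc i)
  define k where "k = Suc i"
  have p: "y \<bullet> y + e > 0" for y :: "real^'n"
    using assms(1) by (simp add: add_nonneg_pos)
  define c where "c j = (- 4) ^ k * (bubble_coeff m k j * e ^ j)" for j
  define q where "q t = (\<Sum>j\<le>k. c j * inverse (t + e) ^ (k + j))" for t
  define q' where "q' t = (\<Sum>j\<le>k. c j * (- real (k + j) * inverse (t + e) ^ (k + j + 1)))" for t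
  define q'' where "q'' t = (\<Sum>j\<le>k. c j * (real (k + j) * real (k + j + 1) * inverse (t + e) ^ (k + j + 2)))" for t
  have d0: "((\<lambda>t. inverse (t + e) ^ n) has_real_derivative - real n * inverse (t + e) ^ (n + 1)) (at t)"
    if "t + e > 0" for t n
  proof -
    have "((\<lambda>t. inverse (t + e)) has_real_derivative - (inverse (t + e) ^ 2)) (at t)"
      using that by (auto intro!: derivative_eq_intros simp: power2_eq_square inverse_eq_divide)
    then have "((\<lambda>t. inverse (t + e) ^ n) has_real_derivative
        real n * (- (inverse (t + e) ^ 2) * inverse (t + e) ^ (n - Suc 0))) (at t)"
      by (rule DERIV_power)
    also have "real n * (- (inverse (t + e) ^ 2) * inverse (t + e) ^ (n - Suc 0))
        = - real n * inverse (t + e) ^ (n + 1)"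
      by (cases n) (simp_all add: power2_eq_square algebra_simps)
    finally show ?thesis .
  qed
  have d1: "(q has_real_derivative q' t) (at t)" if "t + e > 0" for t
    unfolding q_def[abs_def] q'_def
    by (intro DERIV_sum DERIV_cmult d0 that)
  have d2: "(q' has_real_derivative q'' t) (at t)" if "t + e > 0" for t
  proof -
    have "((\<lambda>t. - real (k + j) * inverse (t + e) ^ (k + j + 1)) has_real_derivative
        - real (k + j) * (- real (k + j + 1) * inverse (t + e) ^ (k + j + 1 + 1))) (at t)" for j
      by (intro DERIV_cmult d0 that)
    moreover have "- real (k + j) * (- real (k + j + 1) * inverse (t + e) ^ (k + j + 1 + 1))
        = real (k + j) * real (k + j + 1) * inverse (t + e) ^ (k + j + 2)" for j
      by (simp add: algebra_simps)
    ultimately have "((\<lambda>t. - real (k + j) * inverse (t + e) ^ (k + j + 1)) has_real_derivative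
        real (k + j) * real (k + j + 1) * inverse (t + e) ^ (k + j + 2)) (at t)" for j
      by (simp only:)
    then show ?thesis
      unfolding q'_def[abs_def] q''_def by (intro DERIV_sum DERIV_cmult) auto
  qed
  define s z where "s = x \<bullet> x" and "z = inverse (s + e)"
  have sz: "s * z = 1 - e * z"
    using p[of x] by (simp add: s_def z_def field_simps)
  have "(laplacian ^^ Suc k) (\<lambda>x. - ln (x \<bullet> x + e)) x = laplacian (\<lambda>x. q (x \<bullet> x)) x"
  proof -
    have "(laplacian ^^ k) (\<lambda>x::real^'n. - ln (x \<bullet> x + e)) = (\<lambda>x. q (x \<bullet> x))"
      using Suc.IH unfolding k_def[symmetric]
      by (intro ext) (simp add: q_def c_def bubble_def sum_distrib_left mult.assoc)
    then show ?thesis by simp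
  qed
  also have "\<dots> = 4 * s * q'' s + 2 * real CARD('n) * q' s"
    unfolding s_def by (rule laplacian_radial[of UNIV]) (auto intro!: d1 d2 p)
  also have "\<dots> = (\<Sum>j\<le>k. c j * (4 * (s * z) * (real (k + j) * real (k + j + 1)) * z ^ (k + j + 1)
      - 4 * real m * real (k + j) * z ^ (k + j + 1)))"
    by (simp add: q''_def q'_def N z_def sum_distrib_left algebra_simps flip: sum.distrib sum_subtractf)
  also have "\<dots> = (\<Sum>j\<le>k. (- 4) ^ Suc k * (bubble_coeff m k j * e ^ j *
     (real (k + j) * (real m - 1 - real (k + j)) * z ^ (k + j + 1)
      + e * (real (k + j) * real (k + j + 1)) * z ^ (k + j + 2))))"
    unfolding sz by (intro sum.cong refl) (simp add: c_def algebra_simps)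
  also have "\<dots> = (- 4) ^ Suc k * bubble m (Suc k) e z"
    unfolding sum_distrib_left[symmetric] by (subst bubble_Suc) (auto simp: k_def)
  finally show ?case
    by (simp add: k_def s_def z_def)
qed

subsection \<open>A smooth cutoff\<close>

lemma tendsto_poly_exp_neg: "((\<lambda>s::real. poly p s * exp (- s)) \<longlongrightarrow> 0) at_top"
proof -
  have "((\<lambda>s. \<Sum>i\<le>degree p. coeff p i * (s ^ i / exp s)) \<longlongrightarrow> (\<Sum>i\<le>degree p. coeff p i * 0)) at_top"
    by (intro tendsto_intros tendsto_power_div_exp_0)
  then show ?thesis
    by (simp add: poly_altdef sum_distrib_right exp_minus divide_inverse mult.assoc)
qed

text \<open>The functions \<open>p(1/t) exp(-1/t)\<close>, extended by zero: a class closed under differentiation.\<close>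

definition flat :: "real poly \<Rightarrow> real \<Rightarrow> real" where
  "flat p t = (if t > 0 then poly p (inverse t) * exp (- inverse t) else 0)"

text \<open>For \<open>t > 0\<close> the chain rule gives
  \<open>t^(-2) (p - p')(1/t) exp(-1/t)\<close>, and \<open>[:0, 0, 1:]\<close> is the polynomial
  \<open>X^2\<close>. At the origin the difference quotient is \<open>(X p)(1/t) exp(-1/t)\<close>
  from the right, which tends to 0.\<close>

lemma flat_has_derivative:
  "(flat p has_real_derivative flat ([:0, 0, 1:] * (p - pderiv p)) t) (at t)"
proof -
  consider "t > 0" | "t < 0" | "t = 0" by linarith
  then show ?thesis
  proof cases
    case 1
    have "((\<lambda>t. poly p (inverse t) * exp (- inverse t)) has_real_derivative
        flat ([:0, 0, 1:] * (p - pderiv p)) t) (at t)"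
      using 1 by (auto intro!: derivative_eq_intros poly_DERIV[THEN DERIV_chain2]
          simp: flat_def algebra_simps)
    then show ?thesis
      by (rule has_field_derivative_transform_within_open[of _ _ _ "{0<..}"]) (use 1 in \<open>auto simp: flat_def\<close>)
  next
    case 2
    have "((\<lambda>t. 0) has_real_derivative flat ([:0, 0, 1:] * (p - pderiv p)) t) (at t)"
      using 2 by (simp add: flat_def)
    then show ?thesis
      by (rule has_field_derivative_transform_within_open[of _ _ _ "{..<0}"]) (use 2 in \<open>auto simp: flat_def\<close>)
  next
    case 3
    have "((\<lambda>h. poly ([:0, 1:] * p) (inverse h) * exp (- inverse h)) \<longlongrightarrow> 0) (at_right (0::real))"
      by (rule filterlim_compose[OF tendsto_poly_exp_neg filterlim_inverse_at_top_right])
    moreover have "eventually (\<lambda>h::real. h > 0) (at_right 0)"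
      by (rule eventually_at_right_less)
    then have "eventually (\<lambda>h. poly ([:0, 1:] * p) (inverse h) * exp (- inverse h) = flat p h / h) (at_right 0)"
      by eventually_elim (simp add: flat_def field_simps)
    ultimately have r: "((\<lambda>h. flat p h / h) \<longlongrightarrow> 0) (at_right 0)"
      by (rule Lim_transform_eventually)
    have "eventually (\<lambda>h::real. h < 0) (at_left 0)"
      by (simp add: eventually_at_filter)
    then have "eventually (\<lambda>h. 0 = flat p h / h) (at_left 0)"
      by eventually_elim (simp add: flat_def)
    then have "((\<lambda>h. flat p h / h) \<longlongrightarrow> 0) (at_left 0)"
      by (rule Lim_transform_eventually[OF tendsto_const])
    with r have "((\<lambda>h. flat p h / h) \<longlongrightarrow> 0) (at 0)"
      by (simp add: filterlim_at_split)
    then show ?thesis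
      by (simp add: 3 DERIV_def flat_def)
  qed
qed

lemma flat_seq_exists: "\<exists>F. deriv_seq UNIV F \<and> (\<forall>t\<le>0. F 0 t = 0) \<and> (\<forall>t>0. F 0 t > 0)"
proof (intro exI conjI)
  show "deriv_seq UNIV (\<lambda>k. flat (((\<lambda>p. [:0, 0, 1:] * (p - pderiv p)) ^^ k) 1))"
    unfolding deriv_seq_def funpow.simps comp_def using flat_has_derivative by blast
qed (simp_all add: flat_def)

section \<open>Operations on sequences of derivatives, and the cutoff function\<close>

lemma deriv_seq_subset: "deriv_seq I D \<Longrightarrow> J \<subseteq> I \<Longrightarrow> deriv_seq J D"
  by (auto simp: deriv_seq_def)

lemma deriv_seq_cmult: "deriv_seq I D \<Longrightarrow> deriv_seq I (\<lambda>k t. c * D k t)"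
  by (simp add: deriv_seq_def DERIV_cmult)

lemma deriv_seq_affine:
  assumes "deriv_seq I D"
  shows "deriv_seq {t. c * t + d \<in> I} (\<lambda>k t. c ^ k * D k (c * t + d))"
  unfolding deriv_seq_def
proof (intro allI ballI)
  fix k t assume "t \<in> {t. c * t + d \<in> I}"
  then have "(D k has_real_derivative D (Suc k) (c * t + d)) (at (c * t + d))"
    using assms by (simp add: deriv_seq_def)
  moreover have "((\<lambda>t. c * t + d) has_real_derivative c) (at t)"
    by (auto intro!: derivative_eq_intros)
  ultimately have "((\<lambda>t. D k (c * t + d)) has_real_derivative D (Suc k) (c * t + d) * c) (at t)"
    by (rule DERIV_chain2)
  from DERIV_cmult[OF this, of "c ^ k"]
  show "((\<lambda>t. c ^ k * D k (c * t + d)) has_real_derivative c ^ Suc k * D (Suc k) (c * t + d)) (at t)"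
    by (simp add: algebra_simps)
qed

definition leibniz :: "(nat \<Rightarrow> real \<Rightarrow> real) \<Rightarrow> (nat \<Rightarrow> real \<Rightarrow> real) \<Rightarrow> nat \<Rightarrow> real \<Rightarrow> real" where
  "leibniz D E k t = (\<Sum>i\<le>k. real (k choose i) * (D i t * E (k - i) t))"

lemma leibniz_0 [simp]: "leibniz D E 0 t = D 0 t * E 0 t"
  by (simp add: leibniz_def)

lemma deriv_seq_leibniz:
  assumes D: "deriv_seq I D" and E: "deriv_seq I E"
  shows "deriv_seq I (leibniz D E)"
  unfolding deriv_seq_def
proof (intro allI ballI)
  fix k t assume t: "t \<in> I"
  define a where "a i = D i t * E (Suc k - i) t" for i
  \<comment> \<open>Adding the zero term \<open>k choose Suc k\<close> aligns the two sums to which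
    Pascal's rule leads.\<close>
  have "(\<Sum>i\<le>k. real (k choose i) * a i) = (\<Sum>i\<le>Suc k. real (k choose i) * a i)"
    by simp
  also have "\<dots> = a 0 + (\<Sum>i\<le>k. real (k choose Suc i) * a (Suc i))"
    by (subst sum.atMost_Suc_shift) simp
  finally have "leibniz D E (Suc k) t = (\<Sum>i\<le>k. real (k choose i) * a (Suc i)) + (\<Sum>i\<le>k. real (k choose i) * a i)"
    unfolding leibniz_def a_def[symmetric] by (subst sum.atMost_Suc_shift) (simp add: sum.distrib ring_distribs)
  also have "\<dots> = (\<Sum>i\<le>k. real (k choose i) * (D i t * E (Suc (k - i)) t + D (Suc i) t * E (k - i) t))"
    by (simp add: a_def sum.distrib ring_distribs Suc_diff_le)
  finally have eq: "leibniz D E (Suc k) t = \<dots>" .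
  have "(leibniz D E k has_real_derivative
      (\<Sum>i\<le>k. real (k choose i) * (D i t * E (Suc (k - i)) t + D (Suc i) t * E (k - i) t))) (at t)"
    unfolding leibniz_def[abs_def]
    by (intro DERIV_sum DERIV_cmult DERIV_mult' deriv_seqD[OF D t] deriv_seqD[OF E t])
  then show "(leibniz D E k has_real_derivative leibniz D E (Suc k) t) (at t)"
    by (simp only: eq)
qed

lemma deriv_seq_continuous_on:
  assumes "deriv_seq I D" "J \<subseteq> I"
  shows "continuous_on J (D k)"
  using deriv_seqD[OF assms(1)] assms(2)
  by (intro continuous_at_imp_continuous_on ballI DERIV_isCont) blast

text \<open>One minus the normalised antiderivative of a bump that is positive exactly on
  \<open>(1/4, 1/2)\<close>. The argument will be \<open>|y|^2\<close>; starting at -1 makes 0 an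
  interior point, where two-sided derivatives exist.\<close>

lemma smooth_cutoff_exists:
  "\<exists>X. deriv_seq {-1<..} X \<and> (\<forall>t>-1. t \<le> 1/4 \<longrightarrow> X 0 t = 1) \<and>
     (\<forall>t\<ge>1/2. X 0 t = 0)"
proof -
  obtain F where F: "deriv_seq UNIV F" "\<And>t. t \<le> 0 \<Longrightarrow> F 0 t = 0" "\<And>t. t > 0 \<Longrightarrow> F 0 t > 0"
    using flat_seq_exists by blast
  \<comment> \<open>The bump \<open>F (t - 1/4) F (1/2 - t)\<close>, together with all its
    derivatives.\<close>
  define b where "b = leibniz (\<lambda>k t. 1 ^ k * F k (1 * t + - 1/4)) (\<lambda>k t. (-1) ^ k * F k ((-1) * t + 1/2))"
  have b: "deriv_seq UNIV b"
    unfolding b_def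
    by (intro deriv_seq_leibniz; rule deriv_seq_subset[OF deriv_seq_affine[OF F(1)]]) simp_all
  have b0: "b 0 t = 0" if "t \<le> 1/4 \<or> t \<ge> 1/2" for t
    using that by (auto simp: b_def F)
  have bpos: "b 0 t > 0" if "1/4 < t" "t < 1/2" for t
    using that by (auto simp: b_def intro!: mult_pos_pos F)
  define G where "G t = integral {-1..t} (b 0)" for t
  have G: "(G has_real_derivative b 0 t) (at t)" if "t > -1" for t
  proof -
    have "(G has_real_derivative b 0 t) (at t within {-1..t + 1})"
      unfolding G_def using that
      by (intro integral_has_real_derivative deriv_seq_continuous_on[OF b]) auto
    moreover have "at t within {-1..t + 1} = at t"
      using that by (intro at_within_interior) simp
    ultimately show ?thesis
      by (simp only:)
  qed
  \<comment> \<open>The mean value theorem yields both facts needed about \<open>G\<close>: it is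
    constant where the bump vanishes and increases strictly across
    \<open>(1/4, 1/2)\<close>.\<close>
  have mvt: "\<exists>z. s < z \<and> z < t \<and> G t - G s = (t - s) * b 0 z" if "-1 < s" "s < t" for s t
    by (rule MVT2[OF that(2) G]) (use that in simp)
  define Z where "Z = G (1/2) - G (1/4)"
  have Z: "Z > 0"
  proof -
    obtain z where z: "1/4 < z" "z < 1/2" "Z = (1/2 - 1/4) * b 0 z"
      using mvt[of "1/4" "1/2"] unfolding Z_def by auto
    then show ?thesis
      using bpos[of z] by simp
  qed
  define X where "X k t = (if k = 0 then 1 - (G t - G (1/4)) / Z else - b (k - 1) t / Z)" for k t
  have "deriv_seq {-1<..} X"
    unfolding deriv_seq_def
  proof (intro allI ballI)
    fix k and t :: real assume t: "t \<in> {-1<..}"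
    show "(X k has_real_derivative X (Suc k) t) (at t)"
    proof (cases k)
      case 0
      then show ?thesis
        unfolding X_def using t Z by (auto intro!: derivative_eq_intros G)
    next
      case (Suc k')
      then show ?thesis
        unfolding X_def using Z by (auto intro!: derivative_eq_intros deriv_seqD[OF b])
    qed
  qed
  moreover have "X 0 t = 1" if "t > -1" "t \<le> 1/4" for t
  proof (cases "t = 1/4")
    case False
    then show ?thesis
      using mvt[of t "1/4"] b0 that by (auto simp: X_def)
  next
    case True
    show ?thesis
      unfolding True by (simp add: X_def)
  qed
  moreover have "X 0 t = 0" if "t \<ge> 1/2" for t
  proof (cases "t = 1/2")
    case False
    then have "G t = G (1/2)"
      using mvt[of "1/2" t] b0 that by auto
    then show ?thesis
      using Z by (simp add: X_def Z_def)
  next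
    case True
    show ?thesis
      using Z unfolding True by (simp add: X_def Z_def)
  qed
  ultimately show ?thesis by blast
qed

definition neg_ln_seq :: "nat \<Rightarrow> real \<Rightarrow> real" where
  "neg_ln_seq k s = (if k = 0 then - ln s else (-1) ^ k * fact (k - 1) * inverse s ^ k)"

lemma deriv_seq_neg_ln: "deriv_seq {0<..} neg_ln_seq"
  unfolding deriv_seq_def
proof (intro allI ballI)
  fix k and s :: real assume s: "s \<in> {0<..}"
  show "(neg_ln_seq k has_real_derivative neg_ln_seq (Suc k) s) (at s)"
  proof (cases k)
    case 0
    then show ?thesis
      using s unfolding neg_ln_seq_def by (auto intro!: derivative_eq_intros simp: inverse_eq_divide)
  next
    case (Suc j)
    have "(inverse has_real_derivative (- (inverse s ^ 2))) (at s)"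
      using s DERIV_inverse[of s UNIV] by (simp add: power2_eq_square)
    from DERIV_cmult[OF DERIV_power[OF this, of k], of "(-1) ^ k * fact (k - 1)"]
    show ?thesis
      by (simp add: neg_ln_seq_def[abs_def] Suc power2_eq_square algebra_simps)
  qed
qed

lemma lap_seq_pow_cmult:
  "(lap_seq N ^^ i) (\<lambda>k t. c * D k t) = (\<lambda>k t. c * (lap_seq N ^^ i) D k t)"
  by (induction i) (auto simp: lap_seq_def fun_eq_iff algebra_simps)

text \<open>The coefficients in \<open>lap_seq\<close> are bounded for \<open>t\<close> in
  \<open>[0, 1]\<close> and free of \<open>e\<close>, so bounds uniform in the parameter survive
  iteration. All orders \<open>k\<close> are bounded at once because each step consumes higher
  derivatives.\<close>

lemma lap_seq_pow_bound:
  assumes "T \<subseteq> {0..1}" "\<And>k. \<exists>C. \<forall>e\<in>S. \<forall>t\<in>T. \<bar>D e k t\<bar> \<le> C"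
  shows "\<exists>C. \<forall>e\<in>S. \<forall>t\<in>T. \<bar>(lap_seq N ^^ i) (D e) k t\<bar> \<le> C"
proof (induction i arbitrary: k)
  case (Suc i)
  obtain C1 C2 where C1: "\<forall>e\<in>S. \<forall>t\<in>T. \<bar>(lap_seq N ^^ i) (D e) (Suc (Suc k)) t\<bar> \<le> C1"
    and C2: "\<forall>e\<in>S. \<forall>t\<in>T. \<bar>(lap_seq N ^^ i) (D e) (Suc k) t\<bar> \<le> C2"
    using Suc by metis
  have "\<bar>(lap_seq N ^^ Suc i) (D e) k t\<bar> \<le> 4 * C1 + \<bar>4 * real k + 2 * N\<bar> * C2"
    if "e \<in> S" "t \<in> T" for e t
  proof -
    define E where "E = (lap_seq N ^^ i) (D e)"
    have *: "\<bar>E (Suc (Suc k)) t\<bar> \<le> C1" "\<bar>E (Suc k) t\<bar> \<le> C2"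
      using C1 C2 that by (auto simp: E_def)
    have "\<bar>(lap_seq N ^^ Suc i) (D e) k t\<bar>
        \<le> \<bar>4 * t * E (Suc (Suc k)) t\<bar> + \<bar>(4 * real k + 2 * N) * E (Suc k) t\<bar>"
      by (simp add: E_def lap_seq_def abs_triangle_ineq)
    also have "\<bar>4 * t * E (Suc (Suc k)) t\<bar> \<le> 4 * C1"
      unfolding abs_mult using that assms(1) * by (intro mult_mono) auto
    also have "\<bar>(4 * real k + 2 * N) * E (Suc k) t\<bar> \<le> \<bar>4 * real k + 2 * N\<bar> * C2"
      unfolding abs_mult using * by (intro mult_left_mono) auto
    finally show ?thesis by simp
  qed
  then show ?case by blast
qed (use assms in auto)

lemma bounded_on_compact:
  fixes f :: "real \<Rightarrow> real"
  assumes "continuous_on {a..b} f"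
  shows "\<exists>C\<ge>0. \<forall>t\<in>{a..b}. \<bar>f t\<bar> \<le> C"
proof -
  have "bounded (f ` {a..b})"
    using assms by (intro compact_imp_bounded compact_continuous_image) auto
  then obtain C where "\<forall>t\<in>{a..b}. \<bar>f t\<bar> \<le> C"
    unfolding bounded_iff by auto
  then show ?thesis
    by (intro exI[of _ "max 0 C"]) (auto simp: le_max_iff_disj)
qed

text \<open>In the transition zone \<open>t + e\<close> stays in \<open>[1/4, 1]\<close>, away from
  the singularity of the logarithm. Compactness then gives a bound that does not depend on
  \<open>e\<close>.\<close>

lemma leibniz_bound:
  assumes "deriv_seq {-1<..} X"
  shows "\<exists>C. \<forall>e\<in>{0..1/2}. \<forall>t\<in>{1/4..1/2}. \<bar>leibniz X (\<lambda>k t. neg_ln_seq k (t + e)) k t\<bar> \<le> C"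
proof -
  have "continuous_on {1/4..1/2} (X i)" for i
    by (rule deriv_seq_continuous_on[OF assms]) auto
  from bounded_on_compact[OF this] obtain P where P: "\<And>i. P i \<ge> 0" "\<And>i t. t \<in> {1/4..1/2} \<Longrightarrow> \<bar>X i t\<bar> \<le> P i"
    by metis
  have "continuous_on {1/4..1} (neg_ln_seq i)" for i
    by (rule deriv_seq_continuous_on[OF deriv_seq_neg_ln]) auto
  from bounded_on_compact[OF this] obtain Q where Q: "\<And>i. Q i \<ge> 0" "\<And>i t. t \<in> {1/4..1} \<Longrightarrow> \<bar>neg_ln_seq i t\<bar> \<le> Q i"
    by metis
  have "\<bar>leibniz X (\<lambda>k t. neg_ln_seq k (t + e)) k t\<bar> \<le> (\<Sum>i\<le>k. real (k choose i) * (P i * Q (k - i)))"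
    if "e \<in> {0..1/2}" "t \<in> {1/4..1/2}" for e t
    unfolding leibniz_def using that P Q
    by (intro order.trans[OF sum_abs] sum_mono) (auto simp: abs_mult intro!: mult_left_mono mult_mono)
  then show ?thesis by blast
qed

subsection \<open>Cut-off bubbles\<close>

text \<open>On this open region the cutoff is 1 and the closed form applies; odd \<open>m\<close>
  turns \<open>(-4)^m\<close> into \<open>-(4^m)\<close>. The detour through \<open>lap_seq\<close>
  serves to extract the constant \<open>c\<close>.\<close>

lemma laplacian_pow_cutoff_bubble:
  fixes y :: "real^'n::finite"
  assumes "odd m" and N: "CARD('n) = 2 * m" and X: "deriv_seq {-1<..} X"
    and X1: "\<And>t. t > -1 \<Longrightarrow> t \<le> 1/4 \<Longrightarrow> X 0 t = 1" and e: "0 < e" "e \<le> 1/2"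
    and y: "y \<bullet> y < 1/4"
  shows "- (laplacian ^^ m) (\<lambda>y. c * (X 0 (y \<bullet> y) * - ln (y \<bullet> y + e))) y
    = c * (4 ^ m * fact (2 * m - 1) * e ^ m) * inverse (y \<bullet> y + e) ^ (2 * m)"
proof -
  obtain i where i: "m = Suc i"
    using assms(1) by (cases m) auto
  define U where "U = {y::real^'n. y \<bullet> y < 1/4}"
  have U: "open U"
    unfolding U_def by (intro open_Collect_less continuous_intros)
  have D: "deriv_seq {- e<..} (\<lambda>k t. neg_ln_seq k (t + e))"
    using deriv_seq_affine[OF deriv_seq_neg_ln, of 1 e] by (rule_tac deriv_seq_subset) auto
  have pe: "z \<bullet> z \<in> {- e<..}" for z :: "real^'n"
    using e by (simp add: less_le_trans[of "- e" 0])
  have "(laplacian ^^ m) (\<lambda>y. c * (X 0 (y \<bullet> y) * - ln (y \<bullet> y + e))) y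
      = (laplacian ^^ m) (\<lambda>y. c * neg_ln_seq 0 (y \<bullet> y + e)) y"
  proof (rule laplacian_pow_cong[OF U])
    show "y \<in> U" using y by (simp add: U_def)
    show "c * (X 0 (y \<bullet> y) * - ln (y \<bullet> y + e)) = c * neg_ln_seq 0 (y \<bullet> y + e)" if "y \<in> U" for y
      using that X1[of "y \<bullet> y"] by (simp add: U_def neg_ln_seq_def less_le_trans[of "- 1" 0])
  qed
  also have "\<dots> = (lap_seq (real CARD('n)) ^^ m) (\<lambda>k t. c * neg_ln_seq k (t + e)) 0 (y \<bullet> y)"
    by (rule laplacian_pow_radial[OF deriv_seq_cmult[OF D], of UNIV]) (use pe in auto)
  also have "\<dots> = c * (lap_seq (real CARD('n)) ^^ m) (\<lambda>k t. neg_ln_seq k (t + e)) 0 (y \<bullet> y)"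
    by (simp add: lap_seq_pow_cmult)
  also have "(lap_seq (real CARD('n)) ^^ m) (\<lambda>k t. neg_ln_seq k (t + e)) 0 (y \<bullet> y)
      = (laplacian ^^ m) (\<lambda>y. neg_ln_seq 0 (y \<bullet> y + e)) y"
    by (rule laplacian_pow_radial[OF D, of UNIV, symmetric]) (use pe in auto)
  also have "\<dots> = (- 4) ^ m * bubble m m e (inverse (y \<bullet> y + e))"
    using laplacian_pow_log_bubble[OF e(1) N, of i y] by (simp add: neg_ln_seq_def i)
  also have "\<dots> = - (4 ^ m * fact (2 * m - 1) * e ^ m * inverse (y \<bullet> y + e) ^ (2 * m))"
    using assms(1) by (subst bubble_self) (auto simp: i mult.assoc)
  finally show ?thesis
    by simp
qed

text \<open>The constant \<open>C\<close> is chosen before \<open>e\<close>, while the value at 0 is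
  unbounded as \<open>e\<close> tends to 0. The core is controlled by the closed form, the
  transition zone by uniform bounds, and outside everything vanishes.\<close>

lemma cutoff_bubble_exists:
  assumes "odd m" and N: "CARD('n::finite) = 2 * m"
  shows "\<exists>C\<ge>0. \<forall>e. 0 < e \<and> e \<le> 1/2 \<longrightarrow> (\<exists>V :: real^'n \<Rightarrow> real.
    smooth_on UNIV V \<and> V 0 = - real (2 * m) * ln e \<and>
    (\<forall>y. norm y \<ge> 1 \<longrightarrow> V y = 0 \<and> (laplacian ^^ m) V y = 0) \<and>
    (\<forall>y. - C \<le> V y \<and> - C \<le> - (laplacian ^^ m) V y \<and> - (laplacian ^^ m) V y \<le> C * exp (V y)))"
proof -
  obtain X where X: "deriv_seq {-1<..} X"
    and X1: "\<And>t. t > -1 \<Longrightarrow> t \<le> 1/4 \<Longrightarrow> X 0 t = 1" and X0: "\<And>t. t \<ge> 1/2 \<Longrightarrow> X 0 t = 0"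
    using smooth_cutoff_exists by blast
  \<comment> \<open>With this factor \<open>exp V\<close> equals \<open>(|y|^2 + e)^(-2m)\<close> in
    the core, the very power in the closed form.\<close>
  define c where "c = real (2 * m)"
  define W where "W e = (\<lambda>k t. c * leibniz X (\<lambda>k t. neg_ln_seq k (t + e)) k t)" for e
  have W: "deriv_seq {- e<..} (W e)" if "e \<le> 1/2" for e
  proof -
    have "deriv_seq {- e<..} (\<lambda>k t. neg_ln_seq k (t + e))"
      using deriv_seq_affine[OF deriv_seq_neg_ln, of 1 e] by (rule_tac deriv_seq_subset) auto
    moreover have "deriv_seq {- e<..} X"
      by (rule deriv_seq_subset[OF X]) (use that in auto)
    ultimately show ?thesis
      unfolding W_def by (intro deriv_seq_cmult deriv_seq_leibniz)
  qed
  define T where "T = {1/4..1/2::real}"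
  have T: "T \<subseteq> {0..1}"
    by (auto simp: T_def)
  have Wb: "\<exists>C. \<forall>e\<in>{0..1/2}. \<forall>t\<in>T. \<bar>W e k t\<bar> \<le> C" for k
  proof -
    obtain C where C: "\<forall>e\<in>{0..1/2}. \<forall>t\<in>{1/4..1/2}. \<bar>leibniz X (\<lambda>k t. neg_ln_seq k (t + e)) k t\<bar> \<le> C"
      using leibniz_bound[OF X] by blast
    then have "\<bar>W e k t\<bar> \<le> c * C" if "e \<in> {0..1/2}" "t \<in> T" for e t
      using that by (auto simp: W_def T_def abs_mult c_def intro!: mult_left_mono)
    then show ?thesis by blast
  qed
  obtain C1 where C1: "\<And>e t. e \<in> {0..1/2} \<Longrightarrow> t \<in> T \<Longrightarrow> \<bar>W e 0 t\<bar> \<le> C1"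
    using Wb by blast
  obtain C2 where C2: "\<And>e t. e \<in> {0..1/2} \<Longrightarrow> t \<in> T \<Longrightarrow>
      \<bar>(lap_seq (real CARD('n)) ^^ m) (W e) 0 t\<bar> \<le> C2"
    using lap_seq_pow_bound[where D = W, OF T Wb] by blast
  define C3 where "C3 = c * (4 ^ m * fact (2 * m - 1))"
  \<comment> \<open>The second summand serves the transition zone, where \<open>exp V\<close> may be
    as small as \<open>exp (-|C1|)\<close>; \<open>C3\<close> serves the core, where
    \<open>e^m\<close> is at most 1.\<close>
  define C where "C = \<bar>C1\<bar> + \<bar>C2\<bar> * exp \<bar>C1\<bar> + C3"
  have C3: "C3 \<ge> 0"
    by (simp add: C3_def c_def)
  have "\<bar>C2\<bar> * 1 \<le> \<bar>C2\<bar> * exp \<bar>C1\<bar>"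
    by (intro mult_left_mono) auto
  then have C: "C \<ge> 0" "C \<ge> \<bar>C1\<bar>" "C \<ge> \<bar>C2\<bar>" "C \<ge> \<bar>C2\<bar> * exp \<bar>C1\<bar>" "C \<ge> C3"
    using C3 by (auto simp: C_def)
  have main: "smooth_on UNIV V \<and> V 0 = - real (2 * m) * ln e \<and>
    (\<forall>y. norm y \<ge> 1 \<longrightarrow> V y = 0 \<and> (laplacian ^^ m) V y = 0) \<and>
    (\<forall>y. - C \<le> V y \<and> - C \<le> - (laplacian ^^ m) V y \<and> - (laplacian ^^ m) V y \<le> C * exp (V y))"
    if e: "0 < e" "e \<le> 1/2" and V: "V = (\<lambda>y. W e 0 (y \<bullet> y))" for e and V :: "real^'n \<Rightarrow> real"
  proof (intro conjI allI impI)
    have pe: "z \<bullet> z \<in> {- e<..}" for z :: "real^'n"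
      using e by (simp add: less_le_trans[of "- e" 0])
    show "smooth_on UNIV V"
      unfolding V by (rule smooth_on_radial[OF W[OF e(2)]]) (use pe in auto)
    have V': "V = (\<lambda>y. c * (X 0 (y \<bullet> y) * - ln (y \<bullet> y + e)))"
      by (simp add: V W_def neg_ln_seq_def)
    show "V 0 = - real (2 * m) * ln e"
      using X1[of 0] by (simp add: V' c_def)
    \<comment> \<open>The strict inequality makes the region open, so the iterated Laplacian
      vanishes there too; the sphere \<open>y \<bullet> y = 1/2\<close> is left to the transition
      zone.\<close>
    define U where "U = {y::real^'n. y \<bullet> y > 1/2}"
    have U: "open U"
      unfolding U_def by (intro open_Collect_less continuous_intros)
    have "partial i (\<lambda>y::real^'n. 0) = (\<lambda>y. 0)" for i
      by (intro ext partial_eqI[OF has_derivative_const])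
    then have "laplacian (\<lambda>y::real^'n. 0) = (\<lambda>y. 0)"
      by (simp add: laplacian_def[abs_def])
    then have "(laplacian ^^ k) (\<lambda>y. 0) = (\<lambda>y::real^'n. 0)" for k
      by (induction k) simp_all
    then have out: "V y = 0 \<and> (laplacian ^^ m) V y = 0" if "y \<bullet> y > 1/2" for y
      using laplacian_pow_cong[OF U, of V "\<lambda>y. 0" y m] that X0 by (simp add: U_def V')
    show "V y = 0" "(laplacian ^^ m) V y = 0" if "norm y \<ge> 1" for y
    proof -
      have "(norm y)\<^sup>2 \<ge> 1"
        using that by (simp add: one_le_power)
      then show "V y = 0" "(laplacian ^^ m) V y = 0"
        using out[of y] by (auto simp: power2_norm_eq_inner)
    qed
    fix y :: "real^'n"
    have "- C \<le> V y \<and> - C \<le> - (laplacian ^^ m) V y \<and> - (laplacian ^^ m) V y \<le> C * exp (V y)"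
    proof -
      consider "y \<bullet> y < 1/4" | "y \<bullet> y > 1/2" | "y \<bullet> y \<in> T"
        unfolding T_def atLeastAtMost_iff by linarith
      then show ?thesis
      proof cases
        case 1
        define s where "s = y \<bullet> y + e"
        have s: "0 < s" "s \<le> 1"
          using 1 e by (auto simp: s_def add_nonneg_pos)
        have Vy: "V y = c * - ln s"
          using X1[of "y \<bullet> y"] 1 by (simp add: V' s_def less_le_trans[of "- 1" 0])
        have L: "- (laplacian ^^ m) V y = C3 * e ^ m * inverse s ^ (2 * m)"
          using laplacian_pow_cutoff_bubble[OF assms X X1 e 1, of c] by (simp add: V' C3_def s_def)
        have "exp (V y) = inverse s ^ (2 * m)"
          unfolding Vy c_def exp_of_nat_mult using s by (simp add: exp_minus)
        moreover have "C3 * e ^ m \<le> C * 1"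
          using C3 C e by (intro mult_mono power_le_one) auto
        then have "C3 * e ^ m * inverse s ^ (2 * m) \<le> C * inverse s ^ (2 * m)"
          using s by (intro mult_right_mono) auto
        moreover have "0 \<le> V y"
          using s by (simp add: Vy c_def mult_nonneg_nonpos)
        moreover have "0 \<le> C3 * e ^ m * inverse s ^ (2 * m)"
          using C3 e s by simp
        ultimately show ?thesis
          using C L by auto
      next
        case 2
        then show ?thesis
          using out[of y] C by simp
      next
        case 3
        have "(laplacian ^^ m) V y = (lap_seq (real CARD('n)) ^^ m) (W e) 0 (y \<bullet> y)"
          unfolding V by (rule laplacian_pow_radial[OF W[OF e(2)], of UNIV]) (use pe in auto)
        then have L: "\<bar>(laplacian ^^ m) V y\<bar> \<le> \<bar>C2\<bar>"
          using C2[of e "y \<bullet> y"] 3 e by (simp add: T_def)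
        have Vy: "\<bar>V y\<bar> \<le> \<bar>C1\<bar>"
          using C1[of e "y \<bullet> y"] 3 e by (simp add: T_def V)
        have "1 \<le> exp (\<bar>C1\<bar> + V y)"
          using Vy by simp
        then have "\<bar>C2\<bar> * 1 \<le> \<bar>C2\<bar> * exp (\<bar>C1\<bar> + V y)"
          by (intro mult_left_mono) auto
        also have "\<dots> = \<bar>C2\<bar> * exp \<bar>C1\<bar> * exp (V y)"
          by (simp add: exp_add)
        also have "\<dots> \<le> C * exp (V y)"
          using C by (intro mult_right_mono) auto
        finally show ?thesis
          using L Vy C by auto
      qed
    qed
    then show "- C \<le> V y" "- C \<le> - (laplacian ^^ m) V y" "- (laplacian ^^ m) V y \<le> C * exp (V y)"
      by auto
  qed
  show ?thesis
    using main C(1) by blast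
qed

section \<open>Iterated Laplacians of powers of the norm\<close>

lemma laplacian_pow_powr:
  fixes x :: "real^'n::finite"
  assumes N: "CARD('n) = 2 * m" and "x \<noteq> 0"
  shows "(laplacian ^^ Suc k) (\<lambda>x. B + A * (x \<bullet> x) powr (- p)) x
    = A * 4 ^ Suc k * (\<Prod>j\<le>k. (p + real j) * (p + real j + 1 - real m)) * (x \<bullet> x) powr (- p - real (Suc k))"
proof -
  \<comment> \<open>In dimension \<open>2m\<close> the two terms combine to
    \<open>4 p (p + 1 - m)\<close>. All of \<open>A\<close>, \<open>B\<close>, \<open>p\<close> stay
    general, because later steps use it with \<open>B = 0\<close> and a larger exponent.\<close>
  have one: "laplacian (\<lambda>x. B + A * (x \<bullet> x) powr (- p)) x
      = (A * 4 * (p * (p + 1 - real m))) * (x \<bullet> x) powr (- p - 1)" if "x \<noteq> 0" for A B p and x :: "real^'n"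
  proof -
    have "laplacian (\<lambda>x. B + A * (x \<bullet> x) powr (- p)) x = 4 * (x \<bullet> x) * (A * (- p * ((- p - 1) * (x \<bullet> x) powr (- p - 1 - 1))))
        + 2 * real CARD('n) * (A * (- p * (x \<bullet> x) powr (- p - 1)))"
      by (rule laplacian_radial[of "- {0}"])
        (use that in \<open>auto intro!: derivative_eq_intros simp: algebra_simps\<close>)
    also have "(x \<bullet> x) powr (- p - 1 - 1) = (x \<bullet> x) powr (- p - 1) / (x \<bullet> x)"
      using that by (subst powr_diff) simp
    also have "4 * (x \<bullet> x) * (A * (- p * ((- p - 1) * ((x \<bullet> x) powr (- p - 1) / (x \<bullet> x)))))
        = 4 * A * p * (p + 1) * (x \<bullet> x) powr (- p - 1)"
      using that by (simp add: field_simps)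
    finally show ?thesis
      by (simp add: N algebra_simps)
  qed
  show ?thesis
    using assms(2)
  proof (induction k arbitrary: x)
    case 0
    show ?case
      using one[OF 0] by (simp add: algebra_simps)
  next
    case (Suc k)
    define P where "P = A * 4 ^ Suc k * (\<Prod>j\<le>k. (p + real j) * (p + real j + 1 - real m))"
    have "laplacian ((laplacian ^^ Suc k) (\<lambda>x. B + A * (x \<bullet> x) powr (- p))) x
        = laplacian (\<lambda>x. 0 + P * (x \<bullet> x) powr (- (p + real (Suc k)))) x"
    proof (rule laplacian_cong[of "- {0}"])
      fix y :: "real^'n" assume "y \<in> - {0}"
      then have "y \<noteq> 0" by simp
      have eq: "- (p + real (Suc k)) = - p - real (Suc k)"
        by simp
      show "(laplacian ^^ Suc k) (\<lambda>x. B + A * (x \<bullet> x) powr (- p)) y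
          = 0 + P * (y \<bullet> y) powr (- (p + real (Suc k)))"
        unfolding eq P_def Suc.IH[OF \<open>y \<noteq> 0\<close>] by (simp only: add_0)
    qed (use Suc.prems in auto)
    also have "\<dots> = (P * 4 * ((p + real (Suc k)) * (p + real (Suc k) + 1 - real m))) * (x \<bullet> x) powr (- (p + real (Suc k)) - 1)"
      by (rule one[OF Suc.prems])
    finally show ?case
      by (simp add: P_def algebra_simps)
  qed
qed

lemma smooth_on_powr:
  "smooth_on (- {0}) (\<lambda>x::real^'n::finite. B + A * (x \<bullet> x) powr (- p))"
proof -
  define D where "D k t = (if k = 0 then B else 0) + A * (\<Prod>j<k. - p - real j) * t powr (- p - real k)" for k t
  have "deriv_seq {0<..} D"
    unfolding deriv_seq_def
  proof (intro allI ballI)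
    fix k and t :: real assume "t \<in> {0<..}"
    then have "((\<lambda>t. t powr (- p - real k)) has_real_derivative (- p - real k) * t powr (- p - real k - 1)) (at t)"
      by (intro has_real_derivative_powr) auto
    then have "((\<lambda>t. (if k = 0 then B else 0) + A * (\<Prod>j<k. - p - real j) * t powr (- p - real k)) has_real_derivative
        0 + A * (\<Prod>j<k. - p - real j) * ((- p - real k) * t powr (- p - real k - 1))) (at t)"
      by (intro DERIV_add DERIV_const DERIV_cmult)
    then show "(D k has_real_derivative D (Suc k) t) (at t)"
      by (simp add: D_def[abs_def] algebra_simps)
  qed
  then have "smooth_on (- {0}) (\<lambda>x::real^'n. D 0 (x \<bullet> x))"
    by (rule smooth_on_radial) auto
  then show ?thesis
    by (simp add: D_def)
qed

text \<open>The factor \<open>j + 5/2 - m\<close> is negative exactly for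
  \<open>j \<le> m - 3\<close>. That makes \<open>m - 2\<close> negative factors, an odd number. The
  value \<open>3/2\<close> of the exponent corresponds to \<open>|x|^(-3)\<close>.\<close>

lemma powr_sign_prod_neg:
  assumes "odd m" "m \<ge> 3"
  shows "(\<Prod>j\<le>m - 1. (3/2 + real j) * (3/2 + real j + 1 - real m)) < 0"
proof -
  define k where "k = m - 3"
  have m: "m - 1 = Suc (Suc k)" "m = k + 3" "even k"
    using assms by (auto simp: k_def)
  have "(\<Prod>j\<le>k. (3/2 + real j) * (3/2 + real j + 1 - real m)) < 0"
  proof -
    have "(\<Prod>j\<le>k. (3/2 + real j) * (3/2 + real j + 1 - real m))
        = (\<Prod>j\<le>k. - ((3/2 + real j) * (real m - 5/2 - real j)))"
      by (intro prod.cong) (auto simp: algebra_simps)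
    also have "\<dots> = (-1) ^ Suc k * (\<Prod>j\<le>k. (3/2 + real j) * (real m - 5/2 - real j))"
      by (simp add: prod_uminus)
    also have "\<dots> = - (\<Prod>j\<le>k. (3/2 + real j) * (real m - 5/2 - real j))"
      using m by simp
    finally have "(\<Prod>j\<le>k. (3/2 + real j) * (3/2 + real j + 1 - real m)) = \<dots>" .
    moreover have "(\<Prod>j\<le>k. (3/2 + real j) * (real m - 5/2 - real j)) > 0"
      using m by (intro prod_pos) auto
    ultimately show ?thesis by linarith
  qed
  then show ?thesis
    unfolding m(1) by (simp add: m(2) mult_neg_pos)
qed

subsection \<open>Gluing the bubbles\<close>

lemma powr_norm_eq:
  fixes x :: "'a::real_inner"
  assumes "x \<noteq> 0"
  shows "(x \<bullet> x) powr (- (3/2) - real k) = inverse (norm x) ^ (2 * k + 3)"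
proof -
  have "x \<bullet> x = norm x powr 2"
    using assms by (simp add: power2_norm_eq_inner)
  moreover have "2 * (- (3/2) - real k) = - real (2 * k + 3)"
    by simp
  ultimately have "(x \<bullet> x) powr (- (3/2) - real k) = norm x powr (- real (2 * k + 3))"
    by (simp only: powr_powr)
  also have "\<dots> = inverse (norm x ^ (2 * k + 3))"
    unfolding powr_minus using assms by (subst powr_realpow) auto
  finally show ?thesis
    by (simp add: power_inverse)
qed

text \<open>Raise \<open>t \<le> 1 + t^3 \<le> k (1 + t^3/k)\<close> to the power \<open>k\<close>
  and use \<open>(1 + y/k)^k \<le> exp y\<close>.\<close>

lemma power_le_exp_cube:
  fixes t :: real
  assumes "t \<ge> 0" "k > 0"
  shows "t ^ k \<le> real k ^ k * exp (t ^ 3)"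
proof -
  have "t \<le> 1 + t ^ 3"
  proof (cases "t \<le> 1")
    case True
    then show ?thesis
      using assms by (simp add: add_increasing2)
  next
    case False
    then have "t ^ 1 \<le> t ^ 3"
      by (intro power_increasing) auto
    then show ?thesis by simp
  qed
  also have "1 + t ^ 3 \<le> real k * (1 + t ^ 3 / real k)"
    using assms by (simp add: algebra_simps)
  finally have "t ^ k \<le> (real k * (1 + t ^ 3 / real k)) ^ k"
    using assms by (intro power_mono) auto
  also have "\<dots> = real k ^ k * (1 + t ^ 3 / real k) ^ k"
    by (rule power_mult_distrib)
  also have "(1 + t ^ 3 / real k) ^ k \<le> exp (t ^ 3)"
  proof (rule exp_ge_one_plus_x_over_n_power_n)
    show "- real k \<le> t ^ 3"
      using zero_le_power[OF assms(1), of 3] by linarith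
  qed (rule assms)
  finally show ?thesis
    by (simp add: mult_left_mono)
qed

text \<open>The pointwise inequalities with \<open>t = 1/|x|\<close>: \<open>a t^(2m+3)\<close> is
  \<open>-\<Delta>^m\<close> of the singular base, \<open>V\<close> and \<open>Q\<close> are the
  values of a bubble and of its \<open>-\<Delta>^m\<close>, and \<open>R\<close> is the scaling
  factor, 0 off the bubble's ball.\<close>

lemma growth_estimate:
  fixes t :: real
  assumes "m > 0" "t \<ge> 0" and "A \<ge> 1" "a \<ge> 0" "C \<ge> 0" "0 \<le> R" "R \<le> 9 ^ m * t ^ (2 * m)"
    and R: "R = 0 \<or> 1 \<le> t" and "9 ^ m * C \<le> a"
    and B: "B \<ge> C + 1 + (a * exp C + 9 ^ m * C) * (real (2 * m) ^ (2 * m) + real (2 * m + 3) ^ (2 * m + 3))"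
    and V: "- C \<le> V" "- C \<le> Q" "Q \<le> C * exp V" and "lam \<ge> 1"
  shows "0 \<le> a * t ^ (2 * m + 3) + R * Q" "1 \<le> B + A * t ^ 3 + V"
    "a * t ^ (2 * m + 3) + R * Q \<le> exp ((B + A * t ^ 3 + V) powr lam)"
proof -
  show "0 \<le> a * t ^ (2 * m + 3) + R * Q"
    using R
  proof
    \<comment> \<open>Only where a bubble is active must the base compensate, and there
      \<open>t^(2m)\<close> is at most \<open>t^(2m+3)\<close>.\<close>
    assume t: "1 \<le> t"
    have "R * (- Q) \<le> R * C"
      using assms by (intro mult_left_mono) auto
    also have "\<dots> \<le> 9 ^ m * t ^ (2 * m) * C"
      using assms by (intro mult_right_mono) auto
    also have "\<dots> = (9 ^ m * C) * t ^ (2 * m)"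
      by simp
    also have "\<dots> \<le> a * t ^ (2 * m + 3)"
      using assms t by (intro mult_mono power_increasing) auto
    finally show ?thesis by simp
  qed (use assms in auto)
  define M where "M = real (2 * m) ^ (2 * m) + real (2 * m + 3) ^ (2 * m + 3)"
  define K where "K = a * exp C + 9 ^ m * C"
  have K: "K \<ge> 0"
    using assms by (simp add: K_def)
  have M: "M \<ge> 0"
    by (simp add: M_def)
  have "0 \<le> A * t ^ 3"
    using assms by simp
  moreover have "K * M \<ge> 0"
    using K M by simp
  ultimately show ge1: "1 \<le> B + A * t ^ 3 + V"
    using B V unfolding K_def[symmetric] M_def[symmetric] by linarith
  \<comment> \<open>Since \<open>V\<close> is at least \<open>-C\<close>, the base term too can be
    given a factor \<open>exp V\<close>, so that both terms share it.\<close>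
  have "1 \<le> exp (C + V)"
    using V by simp
  then have "a * t ^ (2 * m + 3) * 1 \<le> a * t ^ (2 * m + 3) * exp (C + V)"
    using assms by (intro mult_left_mono) auto
  moreover have "R * Q \<le> 9 ^ m * t ^ (2 * m) * (C * exp V)"
  proof -
    have "R * Q \<le> R * (C * exp V)"
      using assms by (intro mult_left_mono) auto
    also have "\<dots> \<le> 9 ^ m * t ^ (2 * m) * (C * exp V)"
      using assms by (intro mult_right_mono) auto
    finally show ?thesis .
  qed
  ultimately have "a * t ^ (2 * m + 3) + R * Q
      \<le> (a * exp C * t ^ (2 * m + 3) + 9 ^ m * C * t ^ (2 * m)) * exp V"
    by (simp add: exp_add algebra_simps)
  also have "\<dots> \<le> (a * exp C * (t ^ (2 * m + 3) + t ^ (2 * m)) + 9 ^ m * C * (t ^ (2 * m + 3) + t ^ (2 * m))) * exp V"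
    using assms by (intro mult_right_mono add_mono mult_left_mono) auto
  also have "\<dots> = K * (t ^ (2 * m + 3) + t ^ (2 * m)) * exp V"
    by (simp add: K_def algebra_simps)
  also have "\<dots> \<le> K * (M * exp (t ^ 3)) * exp V"
  proof (intro mult_right_mono mult_left_mono)
    show "t ^ (2 * m + 3) + t ^ (2 * m) \<le> M * exp (t ^ 3)"
      using power_le_exp_cube[of t "2 * m + 3"] power_le_exp_cube[of t "2 * m"] assms
      by (simp add: M_def distrib_right)
  qed (use K in auto)
  also have "\<dots> = K * M * exp (t ^ 3 + V)"
    by (simp add: exp_add)
  \<comment> \<open>The polynomial constants are paid for by the additive constant:
    \<open>K * M \<le> B \<le> exp B\<close>.\<close>
  also have "\<dots> \<le> exp B * exp (t ^ 3 + V)"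
  proof (intro mult_right_mono)
    show "K * M \<le> exp B"
      using B exp_ge_add_one_self[of B] assms unfolding K_def[symmetric] M_def[symmetric] by linarith
  qed auto
  also have "\<dots> = exp (B + 1 * t ^ 3 + V)"
    by (simp add: exp_add)
  also have "\<dots> \<le> exp (B + A * t ^ 3 + V)"
    using mult_right_mono[OF \<open>1 \<le> A\<close>, of "t ^ 3"] \<open>0 \<le> t\<close> by simp
  also have "\<dots> \<le> exp ((B + A * t ^ 3 + V) powr lam)"
    using powr_mono[OF \<open>lam \<ge> 1\<close> ge1] ge1 by simp
  finally show "a * t ^ (2 * m + 3) + R * Q \<le> exp ((B + A * t ^ 3 + V) powr lam)" .
qed

theorem theorem1p11:
  fixes m :: nat and lam :: real and \<phi> :: "real \<Rightarrow> real"
  assumes "odd m" and "m \<ge> 3" and "CARD('n::finite) = 2 * m"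
    and "lam \<ge> 1"
    and "continuous_on {0<..<1} \<phi>"
    and "\<forall>r\<in>{0<..<1}. \<phi> r > 0"
    and "filterlim \<phi> at_top (at_right 0)"
  shows "\<exists>u :: real^'n \<Rightarrow> real.
           smooth_on (- {0}) u \<and>
           (\<forall>x. x \<noteq> 0 \<longrightarrow> u x > 0) \<and>
           (\<forall>x. x \<noteq> 0 \<longrightarrow> 0 \<le> - (laplacian ^^ m) u x \<and>
                 - (laplacian ^^ m) u x \<le> exp (u x powr lam)) \<and>
           Limsup (at 0) (\<lambda>x. ereal (u x / \<phi> (norm x))) = \<infinity>"
proof -
  obtain C where C: "C \<ge> 0" and exV: "\<forall>e. 0 < e \<and> e \<le> 1/2 \<longrightarrow> (\<exists>V :: real^'n \<Rightarrow> real.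
    smooth_on UNIV V \<and> V 0 = - real (2 * m) * ln e \<and>
    (\<forall>y. norm y \<ge> 1 \<longrightarrow> V y = 0 \<and> (laplacian ^^ m) V y = 0) \<and>
    (\<forall>y. - C \<le> V y \<and> - C \<le> - (laplacian ^^ m) V y \<and> - (laplacian ^^ m) V y \<le> C * exp (V y)))"
    using cutoff_bubble_exists[OF assms(1,3)] by blast
  \<comment> \<open>Distances of the centres from the origin; the ratio 4 keeps the balls of radius
    \<open>s j / 2\<close> in disjoint shells.\<close>
  define s where "s j = (1/4 :: real) ^ Suc j" for j
  have s: "0 < s j" "s j \<le> 1/4" for j
    by (simp_all add: s_def power_le_one)
  have s_less: "4 * s j \<le> s i" if "i < j" for i j
  proof -
    have "s j \<le> (1/4) ^ Suc (Suc i)"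
      unfolding s_def using that by (intro power_decreasing) auto
    then show ?thesis
      by (simp add: s_def)
  qed
  have s_lim: "s \<longlonglongrightarrow> 0"
    unfolding s_def by (intro LIMSEQ_Suc LIMSEQ_power_zero) simp
  \<comment> \<open>Small enough that the peak dominates \<open>j \<phi>(s j)\<close>; the minimum
    with \<open>1/2\<close> meets the range required of a bubble.\<close>
  define e where "e j = min (1/2) (exp (- (real j * \<phi> (s j))))" for j
  have e: "0 < e j" "e j \<le> 1/2" "- ln (e j) \<ge> real j * \<phi> (s j)" for j
  proof -
    show "0 < e j" "e j \<le> 1/2"
      by (auto simp: e_def)
    have "ln (e j) \<le> ln (exp (- (real j * \<phi> (s j))))"
      using \<open>0 < e j\<close> by (subst ln_le_cancel_iff) (auto simp: e_def)
    then show "- ln (e j) \<ge> real j * \<phi> (s j)"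
      by simp
  qed
  have "\<forall>j. \<exists>V :: real^'n \<Rightarrow> real.
    smooth_on UNIV V \<and> V 0 = - real (2 * m) * ln (e j) \<and>
    (\<forall>y. norm y \<ge> 1 \<longrightarrow> V y = 0 \<and> (laplacian ^^ m) V y = 0) \<and>
    (\<forall>y. - C \<le> V y \<and> - C \<le> - (laplacian ^^ m) V y \<and> - (laplacian ^^ m) V y \<le> C * exp (V y))"
    using exV e by blast
  then obtain V :: "nat \<Rightarrow> real^'n \<Rightarrow> real" where
    V: "\<And>j. smooth_on UNIV (V j)" "\<And>j. V j 0 = - real (2 * m) * ln (e j)"
    "\<And>j y. norm y \<ge> 1 \<Longrightarrow> V j y = 0" "\<And>j y. norm y \<ge> 1 \<Longrightarrow> (laplacian ^^ m) (V j) y = 0"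
    "\<And>j y. - C \<le> V j y" "\<And>j y. - C \<le> - (laplacian ^^ m) (V j) y"
    "\<And>j y. - (laplacian ^^ m) (V j) y \<le> C * exp (V j y)"
    by metis

  \<comment> \<open>The coefficient in
    \<open>-\<Delta>^m |x|^(-3) = \<kappa> |x|^(-2m-3)\<close>.\<close>
  define \<kappa> where "\<kappa> = - (4 ^ m * (\<Prod>j\<le>m - 1. (3/2 + real j) * (3/2 + real j + 1 - real m)))"
  have \<kappa>: "\<kappa> > 0"
    using powr_sign_prod_neg[OF assms(1,2)] by (simp add: \<kappa>_def mult_pos_neg)
  \<comment> \<open>Gives \<open>A \<kappa> \<ge> 9^m C\<close>, enough to absorb a negative bubble
    error. The \<open>9^m\<close> is \<open>3^(2m)\<close>, from
    \<open>2 / s j \<le> 3 / |x|\<close> on the ball.\<close>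
  define A where "A = 1 + 9 ^ m * C / \<kappa>"
  have A: "A \<ge> 1" "A * \<kappa> \<ge> 9 ^ m * C" "A * \<kappa> \<ge> 0"
    using \<kappa> C by (auto simp: A_def field_simps)
  define B where "B = C + 1 + (A * \<kappa> * exp C + 9 ^ m * C) * (real (2 * m) ^ (2 * m) + real (2 * m + 3) ^ (2 * m + 3))"
  define base where "base = (\<lambda>x::real^'n. B + A * (x \<bullet> x) powr (- (3/2)))"
  have base: "base x = B + A * inverse (norm x) ^ 3" if "x \<noteq> 0" for x
    using powr_norm_eq[OF that, of 0] by (simp add: base_def)
  have base_smooth: "smooth_on (- {0}) base"
    unfolding base_def by (rule smooth_on_powr)
  have lap_base: "- (laplacian ^^ m) base x = A * \<kappa> * inverse (norm x) ^ (2 * m + 3)" if "x \<noteq> 0" for x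
    using laplacian_pow_powr[OF assms(3) that, of "m - 1" B A "3/2"] powr_norm_eq[OF that, of m] assms(2)
    by (simp add: base_def \<kappa>_def)

  \<comment> \<open>All centres lie on one coordinate axis, with an arbitrary index; only their
    norms matter.\<close>
  define a :: "nat \<Rightarrow> real^'n" where "a j = s j *\<^sub>R axis (undefined::'n) 1" for j
  have norm_a: "norm (a j) = s j" for j
    using s(1)[of j] by (simp add: a_def norm_axis_1)
  \<comment> \<open>The dilation carries the ball of radius \<open>s j / 2\<close> about
    \<open>a j\<close> to the unit ball, outside which \<open>V j\<close> vanishes.\<close>
  define v where "v j x = V j ((2 / s j) *\<^sub>R (x - a j))" for j x
  have v_smooth: "smooth_on UNIV (v j)" for j
    unfolding v_def[abs_def] by (rule smooth_on_affine[OF V(1)])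
  have lap_v: "(laplacian ^^ m) (v j) x = (2 / s j) ^ (2 * m) * (laplacian ^^ m) (V j) ((2 / s j) *\<^sub>R (x - a j))" for j x
    unfolding v_def[abs_def] laplacian_pow_affine[OF V(1)] ..
  define near where "near j x \<longleftrightarrow> norm (x - a j) < s j / 2" for j x
  have norm_ge: "norm ((2 / s j) *\<^sub>R (x - a j)) \<ge> 1 \<longleftrightarrow> \<not> near j x" for j x
    unfolding norm_scaleR near_def using s(1)[of j] by (simp add: field_simps not_less)
  have near_norm: "s j / 2 < norm x" "norm x < 3/2 * s j" if "near j x" for j x
    using that norm_triangle_ineq2[of x "a j"] norm_triangle_ineq3[of x "a j"] norm_a[of j]
    by (auto simp: near_def)
  define u where "u x = base x + (\<Sum>j\<in>{j. near j x}. v j x)" for x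

  \<comment> \<open>Overlapping shells covering the punctured space; \<open>W j\<close> meets the support of no bubble but the \<open>j\<close>-th.\<close>
  define W where "W j = {x::real^'n. 3/8 * s j < norm x} \<inter> (if j = 0 then UNIV else {x. norm x < 2 * s j})" for j
  have W_open: "open (W j)" for j
    unfolding W_def by (intro open_Int open_Collect_less continuous_intros) (auto intro!: open_Collect_less continuous_intros)
  have W0: "W j \<subseteq> - {0}" for j
    using s(1)[of j] by (auto simp: W_def)
  have u_W: "u x = base x + v j x" if x: "x \<in> W j" for j x
  proof -
    \<comment> \<open>Ball \<open>i\<close> lies in \<open>s i / 2 < |x| < 3/2 s i\<close>. For
      \<open>i < j\<close> this is beyond \<open>2 s j\<close>, and for \<open>i > j\<close> below
      \<open>3/8 s j\<close>.\<close>
    have "i = j" if "near i x" for i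
    proof (rule ccontr)
      assume "i \<noteq> j"
      then consider "i < j" | "j < i" by linarith
      then show False
      proof cases
        case 1
        then have "norm x < 2 * s j"
          using x by (simp add: W_def split: if_splits)
        then show False
          using near_norm(1)[OF that] s_less[OF 1] by linarith
      next
        case 2
        have "3/8 * s j < norm x"
          using x by (simp add: W_def)
        then show False
          using near_norm(2)[OF that] s_less[OF 2] by linarith
      qed
    qed
    then have sub: "{i. near i x} \<subseteq> {j}"
      by blast
    have "{i. near i x} = (if near j x then {j} else {})"
    proof (cases "near j x")
      case True
      then show ?thesis
        using sub by auto
    next
      case False
      then show ?thesis
        using sub by auto
    qed
    moreover have "v j x = 0" if "\<not> near j x"
      unfolding v_def by (rule V(3)) (use that in \<open>simp only: norm_ge not_False_eq_True\<close>)
    ultimately show ?thesis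
      by (simp add: u_def)
  qed
  have W_cover: "\<exists>j. x \<in> W j" if "x \<noteq> 0" for x
  proof -
    have "eventually (\<lambda>j. s j < norm x) sequentially"
      using that by (intro order_tendstoD[OF s_lim]) auto
    then obtain j0 where "s j0 < norm x"
      by (auto simp: eventually_sequentially)
    then have ex: "3/8 * s j0 < norm x"
      using s(1)[of j0] by linarith
    \<comment> \<open>Minimality supplies the outer bound: \<open>|x|\<close> is at most
      \<open>3/8 s (j - 1) = 3/2 s j\<close>, which is below \<open>2 s j\<close>.\<close>
    define j where "j = (LEAST j. 3/8 * s j < norm x)"
    have "3/8 * s j < norm x"
      unfolding j_def using ex by (rule LeastI)
    moreover have "norm x < 2 * s j" if "j \<noteq> 0"
    proof -
      obtain i where i: "j = Suc i"
        using \<open>j \<noteq> 0\<close> by (cases j) auto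
      then have "\<not> 3/8 * s i < norm x"
        using not_less_Least[of i "\<lambda>j. 3/8 * s j < norm x"] by (simp add: j_def)
      moreover have "s i = 4 * s j"
        by (simp add: i s_def)
      ultimately show ?thesis
        using s(1)[of j] by linarith
    qed
    ultimately have "x \<in> W j"
      by (simp add: W_def)
    then show ?thesis ..
  qed
  have lap_u: "(laplacian ^^ m) u x = (laplacian ^^ m) base x + (laplacian ^^ m) (v j) x" if "x \<in> W j" for j x
  proof -
    have "(laplacian ^^ m) u x = (laplacian ^^ m) (\<lambda>x. base x + v j x) x"
      by (rule laplacian_pow_cong[OF W_open u_W that])
    also have "\<dots> = (laplacian ^^ m) base x + (laplacian ^^ m) (v j) x"
      by (rule laplacian_pow_add[OF W_open smooth_on_subset[OF base_smooth W0] smooth_on_subset[OF v_smooth] that]) simp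
    finally show ?thesis .
  qed

  have est: "0 \<le> - (laplacian ^^ m) u x \<and> 1 \<le> u x \<and> - (laplacian ^^ m) u x \<le> exp (u x powr lam)"
    if "x \<noteq> 0" for x
  proof -
    obtain j where j: "x \<in> W j"
      using W_cover[OF \<open>x \<noteq> 0\<close>] by blast
    define y where "y = (2 / s j) *\<^sub>R (x - a j)"
    define t where "t = inverse (norm x)"
    \<comment> \<open>Setting the factor to 0 off the ball is harmless, as the bubble's iterated
      Laplacian vanishes there, and it ensures \<open>t \<ge> 1\<close> whenever \<open>R\<close> is
      nonzero.\<close>
    define R where "R = (if near j x then (2 / s j) ^ (2 * m) else 0)"
    have t: "t > 0"
      using that by (simp add: t_def)
    have near: "2 / s j \<le> 3 * t" "1 \<le> t" if "near j x"
    proof -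
      show "2 / s j \<le> 3 * t"
        using near_norm[OF that] s(1)[of j] \<open>x \<noteq> 0\<close> by (simp add: t_def field_simps)
      have "norm x \<le> 1"
        using near_norm[OF that] s(2)[of j] by linarith
      then show "1 \<le> t"
        using \<open>x \<noteq> 0\<close> by (simp add: t_def one_le_inverse)
    qed
    have "(2 / s j) ^ (2 * m) \<le> 9 ^ m * t ^ (2 * m)" if "near j x"
    proof -
      have "(2 / s j) ^ (2 * m) \<le> (3 * t) ^ (2 * m)"
        using near[OF that] s(1)[of j] by (intro power_mono) auto
      also have "\<dots> = 9 ^ m * t ^ (2 * m)"
        by (simp add: power_mult_distrib power_mult)
      finally show ?thesis .
    qed
    then have R: "0 \<le> R" "R \<le> 9 ^ m * t ^ (2 * m)" "R = 0 \<or> 1 \<le> t"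
      using near s(1)[of j] t by (auto simp: R_def)
    have "(laplacian ^^ m) (v j) x = R * (laplacian ^^ m) (V j) y"
      using V(4)[of y j] norm_ge[of j x] by (simp add: lap_v R_def y_def)
    then have lap: "- (laplacian ^^ m) u x = A * \<kappa> * t ^ (2 * m + 3) + R * - (laplacian ^^ m) (V j) y"
      using lap_u[OF j] lap_base[OF that] by (simp add: t_def)
    have ux: "u x = B + A * t ^ 3 + V j y"
      using u_W[OF j] base[OF that] by (simp add: t_def v_def y_def)
    have m0: "m > 0"
      using assms(2) by simp
    show ?thesis
      unfolding lap ux
      using growth_estimate[OF m0 less_imp_le[OF t] A(1) A(3) C R A(2) eq_refl[OF B_def[symmetric]]
          V(5)[of j y] V(6)[of j y] V(7)[of j y] assms(4)]
      by blast
  qed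

  have "smooth_on (- {0}) u"
  proof (rule smooth_on_local)
    fix x :: "real^'n" assume "x \<in> - {0}"
    then obtain j where "x \<in> W j"
      using W_cover by blast
    moreover have "smooth_on (W j) u"
      by (rule smooth_on_cong[OF W_open u_W])
        (auto intro!: smooth_on_add W_open smooth_on_subset[OF base_smooth W0] smooth_on_subset[OF v_smooth])
    ultimately show "\<exists>U. open U \<and> x \<in> U \<and> smooth_on U u"
      using W_open by blast
  qed
  moreover have "Limsup (at 0) (\<lambda>x. ereal (u x / \<phi> (norm x))) = \<infinity>"
  proof (rule ccontr)
    assume "Limsup (at 0) (\<lambda>x. ereal (u x / \<phi> (norm x))) \<noteq> \<infinity>"
    then obtain n where "Limsup (at 0) (\<lambda>x. ereal (u x / \<phi> (norm x))) < ereal (real n)"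
      by (metis less_PInf_Ex_of_nat ereal_infty_less(1))
    then have "eventually (\<lambda>x. ereal (u x / \<phi> (norm x)) < ereal (real n)) (at 0)"
      by (rule Limsup_lessD)
    moreover have "filterlim a (at 0) sequentially"
    proof -
      have "a \<longlonglongrightarrow> 0"
        using s_lim by (simp add: tendsto_norm_zero_iff[symmetric, of a] norm_a)
      moreover have "a j \<noteq> 0" for j
        using norm_a[of j] s(1)[of j] by auto
      ultimately show ?thesis
        by (simp add: filterlim_at)
    qed
    ultimately have "eventually (\<lambda>j. ereal (u (a j) / \<phi> (norm (a j))) < ereal (real n)) sequentially"
      by (rule eventually_compose_filterlim)
    then have "eventually (\<lambda>j. u (a j) / \<phi> (s j) < real n) sequentially"
      by (simp add: norm_a)
    then obtain j0 where j0: "\<And>j. j \<ge> j0 \<Longrightarrow> u (a j) / \<phi> (s j) < real n"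
      by (auto simp: eventually_sequentially)
    \<comment> \<open>At the centre \<open>a j\<close> the function is at least
      \<open>-2m ln (e j) \<ge> j \<phi>(s j)\<close>, so \<open>j \<ge> n\<close> contradicts the
      bound \<open>n\<close>.\<close>
    define j where "j = max j0 n"
    have \<phi>: "\<phi> (s j) > 0"
      using assms(6) s[of j] by (auto intro: le_less_trans)
    have aj: "a j \<in> W j" "a j \<noteq> 0"
      using norm_a[of j] s(1)[of j] by (auto simp: W_def)
    have "real n * \<phi> (s j) \<le> real j * \<phi> (s j)"
      using \<phi> by (intro mult_right_mono) (auto simp: j_def)
    also have "\<dots> \<le> - ln (e j)"
      by (rule e)
    also have "\<dots> \<le> real (2 * m) * - ln (e j)"
    proof -
      have "1 * - ln (e j) \<le> real (2 * m) * - ln (e j)"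
        using e(1,2)[of j] assms(2) by (intro mult_right_mono) auto
      then show ?thesis by simp
    qed
    also have "\<dots> = v j (a j)"
      by (simp add: v_def V(2))
    also have "\<dots> \<le> u (a j)"
    proof -
      have "B \<ge> 0"
        using A C by (simp add: B_def)
      then show ?thesis
        using u_W[OF aj(1)] base[OF aj(2)] A(1) by simp
    qed
    finally have "real n \<le> u (a j) / \<phi> (s j)"
      using \<phi> by (simp add: field_simps)
    then show False
      using j0[of j] by (simp add: j_def)
  qed
  ultimately show ?thesis
    using est by (intro exI[of _ u]) force
qed

end
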